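(* Let $(X,\sigma)$ be a multivariable dynamical system with $n$ maps. Let $\pi$ be a $*$-representation of $\mathrm{C}_0(X)$ on a Hilbert space $\mathcal{H}$, and let $A_1,\dots,A_n$ be contractions on $\mathcal{H}$ satisfying the covariance relations \[ \pi(f)A_i=A_i\pi(f\circ\sigma_i)\quad\text{for } f\in\mathrm{C}_0(X),\ 1\le i\le n. \] Then there is a Hilbert space $\mathcal{K}$ containing $\mathcal{H}$, a $*$-representation $\rho$ of $\mathrm{C}_0(X)$ on $\mathcal{K}$ and isometries $S_1,\dots,S_n$ on $\mathcal{K}$ such that \begin{enumerate} \item[(i)] $\rho(f)S_i=S_i\rho(f\circ\sigma_i)$ for $f\in\mathrm{C}_0(X)$ and $1\le i\le n$. \item[(ii)] $\mathcal{H}$ reduces $\rho$ and $\rho(f)|_{\mathcal{H}}=\pi(f)$ for $f\in\mathrm{C}_0(X)$. \item[(iii)] $\mathcal{H}^\perp$ is invariant for each $S_i$, and $P_{\mathcal{H}}S_i|_{\mathcal{H}}=A_i$ for $1\le i\le n$. \end{enumerate}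
   Context: A multivariable dynamical system $(X,\sigma)$ is a locally compact Hausdorff space $X$ together with $n\ge1$ proper continuous maps $\sigma_1,\dots,\sigma_n$ of $X$ into itself. $P_{\mathcal{H}}$ is the orthogonal projection onto $\mathcal{H}$. *)

theory Defs
  imports "HOL-Analysis.Analysis" "HOL-Library.Function_Algebras"
begin

section \<open>Complex Hilbert spaces\<close>

text \<open>
  Hilbert spaces are given by explicit carriers, so that their existence can be asserted inside a
  formula. The vectors form a linear subspace of an ambient complex vector space, which contributes
  nothing but addition and scalar multiplication: inner product and completeness concern the
  carrier only. An abstract Hilbert space is the case where the carrier is the whole type. The inner
  product is linear in its first argument.

  An inclusion of Hilbert spaces \<open>H\<close> and \<open>K\<close> is rendered by a linear isometry \<open>V\<close> from \<open>H\<close> to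
  \<open>K\<close>, and \<open>H\<close> as a subspace of \<open>K\<close> by \<open>V ` vecs H\<close>. For a Hilbert space generated from \<open>H\<close> by
  countably many operators, functions from lists of naturals to vectors of \<open>H\<close> form a large enough
  ambient space.
\<close>

record 'v inner_space =
  vecs :: "'v set"
  smul :: "complex \<Rightarrow> 'v \<Rightarrow> 'v"
  ip :: "'v \<Rightarrow> 'v \<Rightarrow> complex"

definition hnorm :: "'v inner_space \<Rightarrow> 'v \<Rightarrow> real" where
  "hnorm H x = sqrt (Re (ip H x x))"

locale complex_inner_space =
  fixes H :: "('v::ab_group_add) inner_space"
  assumes ambient: "vector_space (smul H)"
    and carrier: "module.subspace (smul H) (vecs H)"
    and ip_add_left: "\<lbrakk>x \<in> vecs H; y \<in> vecs H; z \<in> vecs H\<rbrakk> \<Longrightarrow> ip H (x + y) z = ip H x z + ip H y z"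
    and ip_smul_left: "\<lbrakk>x \<in> vecs H; z \<in> vecs H\<rbrakk> \<Longrightarrow> ip H (smul H c x) z = c * ip H x z"
    and ip_commute: "\<lbrakk>x \<in> vecs H; y \<in> vecs H\<rbrakk> \<Longrightarrow> ip H y x = cnj (ip H x y)"
    and ip_pos: "\<lbrakk>x \<in> vecs H; x \<noteq> 0\<rbrakk> \<Longrightarrow> 0 < Re (ip H x x)"

locale complex_hilbert_space = complex_inner_space +
  assumes complete:
    "\<lbrakk>\<And>k::nat. s k \<in> vecs H;
      \<And>e. 0 < e \<Longrightarrow> \<exists>N. \<forall>k\<ge>N. \<forall>m\<ge>N. hnorm H (s k - s m) < e\<rbrakk>
     \<Longrightarrow> \<exists>l\<in>vecs H. (\<lambda>k. hnorm H (s k - l)) \<longlonglongrightarrow> 0"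


section \<open>Operators\<close>

text \<open>Operators are HOL functions of which only the values on the carrier are relevant.\<close>

definition linear_map_between ::
    "('v::ab_group_add) inner_space \<Rightarrow> ('w::ab_group_add) inner_space \<Rightarrow> ('v \<Rightarrow> 'w) \<Rightarrow> bool" where
  "linear_map_between H K T \<longleftrightarrow>
     T \<in> vecs H \<rightarrow> vecs K \<and>
     (\<forall>x\<in>vecs H. \<forall>y\<in>vecs H. T (x + y) = T x + T y) \<and>
     (\<forall>c. \<forall>x\<in>vecs H. T (smul H c x) = smul K c (T x))"

definition bounded_operator :: "('v::ab_group_add) inner_space \<Rightarrow> ('v \<Rightarrow> 'v) \<Rightarrow> bool" where
  "bounded_operator H T \<longleftrightarrow>
     linear_map_between H H T \<and> (\<exists>B. \<forall>x\<in>vecs H. hnorm H (T x) \<le> B * hnorm H x)"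

definition contraction :: "('v::ab_group_add) inner_space \<Rightarrow> ('v \<Rightarrow> 'v) \<Rightarrow> bool" where
  "contraction H T \<longleftrightarrow> linear_map_between H H T \<and> (\<forall>x\<in>vecs H. hnorm H (T x) \<le> hnorm H x)"

definition linear_isometry ::
    "('v::ab_group_add) inner_space \<Rightarrow> ('w::ab_group_add) inner_space \<Rightarrow> ('v \<Rightarrow> 'w) \<Rightarrow> bool" where
  "linear_isometry H K V \<longleftrightarrow>
     linear_map_between H K V \<and> (\<forall>x\<in>vecs H. hnorm K (V x) = hnorm H x)"

definition orth_compl :: "'v inner_space \<Rightarrow> 'v set \<Rightarrow> 'v set" where
  "orth_compl H M = {x \<in> vecs H. \<forall>y\<in>M. ip H x y = 0}"

text \<open>Only meaningful for a closed subspace \<open>M\<close>, where the point described exists uniquely.\<close>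

definition orth_proj :: "('v::ab_group_add) inner_space \<Rightarrow> 'v set \<Rightarrow> 'v \<Rightarrow> 'v" where
  "orth_proj H M x = (THE p. p \<in> M \<and> x - p \<in> orth_compl H M)"

definition invariant_under :: "('v \<Rightarrow> 'v) \<Rightarrow> 'v set \<Rightarrow> bool" where
  "invariant_under T M \<longleftrightarrow> T ` M \<subseteq> M"

definition reduces :: "'v inner_space \<Rightarrow> 'v set \<Rightarrow> ('v \<Rightarrow> 'v) \<Rightarrow> bool" where
  "reduces H M T \<longleftrightarrow> invariant_under T M \<and> invariant_under T (orth_compl H M)"


section \<open>Multivariable dynamical systems\<close>

definition multivariable_system :: "'x topology \<Rightarrow> nat \<Rightarrow> (nat \<Rightarrow> 'x \<Rightarrow> 'x) \<Rightarrow> bool" where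
  "multivariable_system X n \<sigma> \<longleftrightarrow>
     locally_compact_space X \<and> Hausdorff_space X \<and> 1 \<le> n \<and>
     (\<forall>i\<in>{1..n}. continuous_map X X (\<sigma> i) \<and> proper_map X X (\<sigma> i))"

text \<open>The library's \<^const>\<open>proper_map\<close> (closed with compact fibres) is the usual notion here.\<close>

lemma proper_map_iff_compact_preimage:
  assumes "locally_compact_space X" "Hausdorff_space X" "continuous_map X X s"
  shows "proper_map X X s \<longleftrightarrow> (\<forall>C. compactin X C \<longrightarrow> compactin X {x \<in> topspace X. s x \<in> C})"
proof
  assume "proper_map X X s"
  then show "\<forall>C. compactin X C \<longrightarrow> compactin X {x \<in> topspace X. s x \<in> C}"
    by (simp add: compactin_proper_map_preimage)
next
  assume "\<forall>C. compactin X C \<longrightarrow> compactin X {x \<in> topspace X. s x \<in> C}"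
  then show "proper_map X X s"
    using assms
    by (intro compact_imp_proper_map)
      (auto simp: locally_compact_imp_k_space Hausdorff_imp_kc_space continuous_map_def)
qed

text \<open>
  The points are those of \<^term>\<open>topspace X\<close>, not of the whole type. Elements of \<open>C\<^sub>0(X)\<close> are
  represented uniquely, by extending them with the value \<open>0\<close> outside \<^term>\<open>topspace X\<close>; this is
  compatible with the pointwise operations, and composition has to restore it.
\<close>

definition C0 :: "'x topology \<Rightarrow> ('x \<Rightarrow> complex) set" where
  "C0 X = {f. continuous_map X euclidean f \<and>
              (\<forall>e>0. compactin X {x \<in> topspace X. e \<le> cmod (f x)}) \<and>
              (\<forall>x. x \<notin> topspace X \<longrightarrow> f x = 0)}"

definition comp_on :: "'x topology \<Rightarrow> ('x \<Rightarrow> complex) \<Rightarrow> ('x \<Rightarrow> 'x) \<Rightarrow> 'x \<Rightarrow> complex" where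
  "comp_on X f s = (\<lambda>x. if x \<in> topspace X then (f \<circ> s) x else 0)"

lemma comp_on_in_C0:
  assumes f: "f \<in> C0 X" and s: "continuous_map X X s" "proper_map X X s"
  shows "comp_on X f s \<in> C0 X"
proof -
  have "continuous_map X euclidean (f \<circ> s)"
    using f s(1) by (auto simp: C0_def intro: continuous_map_compose)
  then have "continuous_map X euclidean (comp_on X f s)"
    by (rule continuous_map_eq) (simp add: comp_on_def)
  moreover have "compactin X {x \<in> topspace X. e \<le> cmod (comp_on X f s x)}" if "0 < e" for e
  proof -
    have "compactin X {x \<in> topspace X. s x \<in> {y \<in> topspace X. e \<le> cmod (f y)}}"
      using f s(2) that by (intro compactin_proper_map_preimage) (auto simp: C0_def)
    moreover have "{x \<in> topspace X. s x \<in> {y \<in> topspace X. e \<le> cmod (f y)}}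
        = {x \<in> topspace X. e \<le> cmod (comp_on X f s x)}"
      using s(1) by (auto simp: comp_on_def continuous_map_def)
    ultimately show ?thesis by simp
  qed
  ultimately show ?thesis by (simp add: C0_def comp_on_def)
qed

text \<open>Representations are not required to be nondegenerate.\<close>

definition star_representation ::
    "'x topology \<Rightarrow> ('v::ab_group_add) inner_space \<Rightarrow> (('x \<Rightarrow> complex) \<Rightarrow> 'v \<Rightarrow> 'v) \<Rightarrow> bool" where
  "star_representation X H \<pi> \<longleftrightarrow>
     (\<forall>f\<in>C0 X. bounded_operator H (\<pi> f)) \<and>
     (\<forall>f\<in>C0 X. \<forall>g\<in>C0 X. \<forall>v\<in>vecs H. \<pi> (\<lambda>x. f x + g x) v = \<pi> f v + \<pi> g v) \<and>
     (\<forall>c. \<forall>f\<in>C0 X. \<forall>v\<in>vecs H. \<pi> (\<lambda>x. c * f x) v = smul H c (\<pi> f v)) \<and>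
     (\<forall>f\<in>C0 X. \<forall>g\<in>C0 X. \<forall>v\<in>vecs H. \<pi> (\<lambda>x. f x * g x) v = \<pi> f (\<pi> g v)) \<and>
     (\<forall>f\<in>C0 X. \<forall>v\<in>vecs H. \<forall>w\<in>vecs H. ip H (\<pi> (\<lambda>x. cnj (f x)) v) w = ip H v (\<pi> f w))"

end

theory Submission
  imports Defs
begin

text \<open>
  For a single contraction \<open>A\<close>, Schaeffer's isometric dilation puts next to \<open>H\<close> infinitely many further
  copies of \<open>H\<close>: a vector \<open>x\<close> of \<open>H\<close> goes to \<open>A x\<close> in \<open>H\<close> plus \<open>D x\<close> in the first extra copy, where
  \<open>D = (I - A* A)\<^sup>1\<^sup>/\<^sup>2\<close> is the defect operator, and each extra copy is shifted to the next one.
  The identity \<open>\<parallel>A x\<parallel>\<^sup>2 + \<parallel>D x\<parallel>\<^sup>2 = \<parallel>x\<parallel>\<^sup>2\<close> makes this an isometry. For several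
  contractions the copies are indexed by words: \<open>K = \<ell>\<^sup>2(words; H)\<close>, the original \<open>H\<close> sits at the empty
  word, and \<open>S i\<close> prepends the letter \<open>i\<close> except that at the empty word it acts by
  \<open>x \<mapsto> A i x\<close> at the empty word plus \<open>D i x\<close> at the word \<open>i\<close>. Vectors at different words are
  orthogonal, so each \<open>S i\<close> is isometric. It maps the complement of the empty word into itself, and its
  compression to the empty word is \<open>A i\<close>.

  The representation has to change from word to word. On the copy indexed by \<open>i\<^sub>1 \<dots> i\<^sub>m\<close> the function
  \<open>f\<close> acts as \<open>\<pi> (f \<circ> \<sigma> i\<^sub>1 \<circ> \<dots> \<circ> \<sigma> i\<^sub>m)\<close>, so that prepending \<open>i\<close> turns \<open>f\<close> into
  \<open>f \<circ> \<sigma> i\<close>, which is the covariance relation for the shift part. At the empty word it is the given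
  relation for \<open>A i\<close>. For the passage from the empty word to the word \<open>i\<close>, the operator \<open>D i\<close> has to
  commute with \<open>\<pi> (f \<circ> \<sigma> i)\<close>. This holds because the covariance relation and its adjoint give
  \<open>A* A \<pi> (f \<circ> \<sigma>) = A* \<pi> f A = \<pi> (f \<circ> \<sigma>) A* A\<close>, and \<open>D\<close> is a limit of polynomials in
  \<open>A* A\<close>.

  Two analytic facts carry the construction. The square root \<open>D\<close> comes from the binomial series of
  \<open>(1 - t)\<^sup>1\<^sup>/\<^sup>2\<close>, whose coefficients are absolutely summable. The series is summed
  weakly, as a bounded sesquilinear form, so that only scalar series occur; the Riesz theorem turns the
  form into an operator (\<open>sqrt_one_minus\<close>, \<open>defect_operator\<close>). The operators \<open>\<pi> (f \<circ> \<sigma>\<^sub>w)\<close> are bounded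
  uniformly in the word \<open>w\<close> because a representation of \<open>C\<^sub>0(X)\<close> satisfies
  \<open>\<parallel>\<pi> f\<parallel> \<le> sup \<bar>f\<bar>\<close> (\<open>rep_norm_le\<close>).
\<close>

section \<open>Complex inner products and the Riesz representation theorem\<close>

context complex_inner_space
begin

lemma subspace_facts:
  shows zero_vecs: "0 \<in> vecs H"
    and add_vecs: "\<lbrakk>x \<in> vecs H; y \<in> vecs H\<rbrakk> \<Longrightarrow> x + y \<in> vecs H"
    and smul_vecs: "x \<in> vecs H \<Longrightarrow> smul H c x \<in> vecs H"
proof -
  interpret V: vector_space "smul H" by (rule ambient)
  have "V.subspace (vecs H)" by (rule carrier)
  then show "0 \<in> vecs H" "\<lbrakk>x \<in> vecs H; y \<in> vecs H\<rbrakk> \<Longrightarrow> x + y \<in> vecs H"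
    "x \<in> vecs H \<Longrightarrow> smul H c x \<in> vecs H"
    by (auto simp: V.subspace_def)
qed

lemma smul_simps:
  shows smul_add: "smul H c (x + y) = smul H c x + smul H c y"
    and smul_add_left: "smul H (c + d) x = smul H c x + smul H d x"
    and smul_smul: "smul H c (smul H d x) = smul H (c * d) x"
    and smul_one: "smul H 1 x = x"
    and smul_zero_right: "smul H c 0 = 0"
    and smul_minus_one: "smul H (-1) x = - x"
proof -
  interpret V: vector_space "smul H" by (rule ambient)
  show "smul H c (x + y) = smul H c x + smul H c y" by (rule V.scale_right_distrib)
  show "smul H (c + d) x = smul H c x + smul H d x" by (rule V.scale_left_distrib)
  show "smul H c (smul H d x) = smul H (c * d) x" "smul H 1 x = x" "smul H c 0 = 0"
    "smul H (-1) x = - x" by simp_all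
qed

lemma diff_vecs: "\<lbrakk>x \<in> vecs H; y \<in> vecs H\<rbrakk> \<Longrightarrow> x - y \<in> vecs H"
  using add_vecs[of x "smul H (-1) y"] smul_vecs[of y "-1"] by (simp add: smul_minus_one)

lemma ip_add_right:
  "\<lbrakk>x \<in> vecs H; y \<in> vecs H; z \<in> vecs H\<rbrakk> \<Longrightarrow> ip H x (y + z) = ip H x y + ip H x z"
  by (metis add_vecs complex_cnj_add ip_add_left ip_commute)

lemma ip_smul_right:
  "\<lbrakk>x \<in> vecs H; y \<in> vecs H\<rbrakk> \<Longrightarrow> ip H x (smul H c y) = cnj c * ip H x y"
  by (metis complex_cnj_mult ip_commute ip_smul_left smul_vecs)

lemma ip_minus:
  shows ip_diff_left: "\<lbrakk>x \<in> vecs H; y \<in> vecs H; z \<in> vecs H\<rbrakk> \<Longrightarrow> ip H (x - y) z = ip H x z - ip H y z"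
    and ip_diff_right: "\<lbrakk>x \<in> vecs H; y \<in> vecs H; z \<in> vecs H\<rbrakk> \<Longrightarrow> ip H z (x - y) = ip H z x - ip H z y"
  using ip_add_left[of x "smul H (-1) y" z] ip_smul_left[of y z "-1"] smul_vecs[of y "-1"]
    ip_add_right[of z x "smul H (-1) y"] ip_smul_right[of z y "-1"]
  by (simp_all add: smul_minus_one)

lemma ip_zero_left: "x \<in> vecs H \<Longrightarrow> ip H 0 x = 0"
  and ip_zero_right: "x \<in> vecs H \<Longrightarrow> ip H x 0 = 0"
  using ip_diff_left[of x x x] ip_diff_right[of x x x] by simp_all

lemma Re_ip_commute: "\<lbrakk>x \<in> vecs H; y \<in> vecs H\<rbrakk> \<Longrightarrow> Re (ip H y x) = Re (ip H x y)"
  using ip_commute[of x y] by simp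

lemma Re_ip_self_nonneg: "x \<in> vecs H \<Longrightarrow> 0 \<le> Re (ip H x x)"
  using ip_pos[of x] ip_zero_left[of 0] zero_vecs by (cases "x = 0") auto

lemma hnorm_nonneg: "x \<in> vecs H \<Longrightarrow> 0 \<le> hnorm H x"
  by (simp add: hnorm_def Re_ip_self_nonneg)

lemma hnorm_squared: "x \<in> vecs H \<Longrightarrow> (hnorm H x)\<^sup>2 = Re (ip H x x)"
  by (simp add: hnorm_def Re_ip_self_nonneg)

lemma ip_self: "x \<in> vecs H \<Longrightarrow> ip H x x = of_real ((hnorm H x)\<^sup>2)"
  using ip_commute[of x x] by (simp add: hnorm_squared complex_eq_iff)

lemma hnorm_zero: "hnorm H 0 = 0"
  using ip_zero_left[OF zero_vecs] by (simp add: hnorm_def)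

lemma hnorm_eq_0_iff: "x \<in> vecs H \<Longrightarrow> hnorm H x = 0 \<longleftrightarrow> x = 0"
  by (cases "x = 0") (use ip_pos[of x] hnorm_zero in \<open>simp_all add: hnorm_def\<close>)

lemma eq_if_ip_eq:
  assumes "x \<in> vecs H" "y \<in> vecs H" "\<And>z. z \<in> vecs H \<Longrightarrow> ip H x z = ip H y z"
  shows "x = y"
proof -
  have "ip H (x - y) (x - y) = 0"
    using assms diff_vecs[of x y] by (simp add: ip_diff_left)
  then show ?thesis using ip_pos[of "x - y"] diff_vecs[OF assms(1,2)] by force
qed

lemma hnorm_squared_add:
  assumes "x \<in> vecs H" "y \<in> vecs H"
  shows "(hnorm H (x + y))\<^sup>2 = (hnorm H x)\<^sup>2 + 2 * Re (ip H x y) + (hnorm H y)\<^sup>2"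
  using assms add_vecs[OF assms]
  by (simp add: hnorm_squared ip_add_left ip_add_right Re_ip_commute[of x y])

lemma hnorm_squared_diff:
  assumes "x \<in> vecs H" "y \<in> vecs H"
  shows "(hnorm H (x - y))\<^sup>2 = (hnorm H x)\<^sup>2 - 2 * Re (ip H x y) + (hnorm H y)\<^sup>2"
  using assms diff_vecs[OF assms]
  by (simp add: hnorm_squared ip_diff_left ip_diff_right Re_ip_commute[of x y])

lemma hnorm_smul:
  assumes "x \<in> vecs H" shows "hnorm H (smul H c x) = cmod c * hnorm H x"
proof -
  have "ip H (smul H c x) (smul H c x) = of_real ((cmod c)\<^sup>2) * ip H x x"
    using assms smul_vecs[OF assms, of c]
    by (simp add: ip_smul_left ip_smul_right mult.assoc[symmetric] complex_norm_square del: of_real_power)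
  then show ?thesis by (simp add: hnorm_def real_sqrt_mult)
qed

lemma Cauchy_Schwarz:
  assumes x: "x \<in> vecs H" and y: "y \<in> vecs H"
  shows "cmod (ip H x y) \<le> hnorm H x * hnorm H y"
proof (cases "y = 0")
  case True
  then show ?thesis using x by (simp add: ip_zero_right hnorm_zero)
next
  case False
  then have pos: "0 < hnorm H y" using y hnorm_eq_0_iff hnorm_nonneg by force
  define c where "c = ip H x y / of_real ((hnorm H y)\<^sup>2)"
  have "0 \<le> (hnorm H (x - smul H c y))\<^sup>2" by simp
  also have "\<dots> = (hnorm H x)\<^sup>2 - 2 * Re (cnj c * ip H x y) + (cmod c)\<^sup>2 * (hnorm H y)\<^sup>2"
    using x y by (simp add: hnorm_squared_diff smul_vecs ip_smul_right hnorm_smul power_mult_distrib)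
  also have "cnj c * ip H x y = of_real ((cmod (ip H x y))\<^sup>2 / (hnorm H y)\<^sup>2)"
    by (simp add: c_def complex_norm_square mult.commute del: of_real_power)
  also have "cmod c = cmod (ip H x y) / (hnorm H y)\<^sup>2"
    by (simp add: c_def norm_divide norm_power)
  also have "(cmod (ip H x y) / (hnorm H y)\<^sup>2)\<^sup>2 * (hnorm H y)\<^sup>2
      = (cmod (ip H x y))\<^sup>2 / (hnorm H y)\<^sup>2"
    using pos by (simp add: power_divide power2_eq_square)
  finally have "(cmod (ip H x y))\<^sup>2 / (hnorm H y)\<^sup>2 \<le> (hnorm H x)\<^sup>2" by simp
  then have "(cmod (ip H x y))\<^sup>2 \<le> (hnorm H x * hnorm H y)\<^sup>2"
    using pos by (simp add: field_simps)
  then show ?thesis by (rule power2_le_imp_le) (use x y in \<open>simp add: hnorm_nonneg\<close>)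
qed

lemma cmod_ip_le:
  assumes "x \<in> vecs H" "y \<in> vecs H"
  shows "cmod (ip H x y) \<le> (hnorm H x)\<^sup>2 + (hnorm H y)\<^sup>2"
proof -
  have "0 \<le> (hnorm H x - hnorm H y)\<^sup>2 + (hnorm H x)\<^sup>2 + (hnorm H y)\<^sup>2" by simp
  then have "hnorm H x * hnorm H y \<le> (hnorm H x)\<^sup>2 + (hnorm H y)\<^sup>2"
    by (simp add: power2_diff)
  then show ?thesis using Cauchy_Schwarz[OF assms] by linarith
qed

lemma hnorm_triangle:
  assumes "x \<in> vecs H" "y \<in> vecs H"
  shows "hnorm H (x + y) \<le> hnorm H x + hnorm H y"
proof (rule power2_le_imp_le)
  have "Re (ip H x y) \<le> hnorm H x * hnorm H y"
    using Cauchy_Schwarz[OF assms] complex_Re_le_cmod order_trans by blast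
  then show "(hnorm H (x + y))\<^sup>2 \<le> (hnorm H x + hnorm H y)\<^sup>2"
    using assms by (simp add: hnorm_squared_add power2_sum)
qed (use assms in \<open>simp add: hnorm_nonneg\<close>)

lemma hnorm_squared_add_le:
  assumes "x \<in> vecs H" "y \<in> vecs H"
  shows "(hnorm H (x + y))\<^sup>2 \<le> 2 * ((hnorm H x)\<^sup>2 + (hnorm H y)\<^sup>2)"
proof -
  have "0 \<le> (hnorm H (x - y))\<^sup>2" by simp
  then show ?thesis using assms by (simp add: hnorm_squared_add hnorm_squared_diff)
qed

end

text \<open>
  The first-order condition at a minimum: a quadratic polynomial in \<open>t\<close> without constant term that is
  never negative has no linear term.
\<close>

lemma linear_term_zero:
  fixes a b :: real
  assumes "0 \<le> b" "\<And>t. 0 \<le> 2 * t * a + t\<^sup>2 * b"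
  shows "a = 0"
proof (rule ccontr)
  assume "a \<noteq> 0"
  have "2 * (- a / (b + 1)) * a + (- a / (b + 1))\<^sup>2 * b = - (a\<^sup>2 * (b + 2) / (b + 1)\<^sup>2)"
    using assms(1) by (simp add: field_simps power2_eq_square add_nonneg_eq_0_iff)
  moreover have "0 < a\<^sup>2 * (b + 2) / (b + 1)\<^sup>2"
    using assms(1) \<open>a \<noteq> 0\<close> by simp
  ultimately show False using assms(2)[of "- a / (b + 1)"] by linarith
qed

text \<open>
  The representing vector is the minimum of \<open>F x = \<parallel>x\<parallel>\<^sup>2 - 2 Re (\<phi> x)\<close>. The functional \<open>F\<close> is bounded
  below, and by the parallelogram identity a minimizing sequence is Cauchy; this avoids closed
  subspaces and orthogonal projections.
\<close>

lemma (in complex_hilbert_space) Riesz_representation: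
  assumes add: "\<And>x y. \<lbrakk>x \<in> vecs H; y \<in> vecs H\<rbrakk> \<Longrightarrow> \<phi> (x + y) = \<phi> x + \<phi> y"
    and smul: "\<And>c x. x \<in> vecs H \<Longrightarrow> \<phi> (smul H c x) = c * \<phi> x"
    and bound: "\<And>x. x \<in> vecs H \<Longrightarrow> cmod (\<phi> x) \<le> C * hnorm H x"
  shows "\<exists>t\<in>vecs H. \<forall>x\<in>vecs H. \<phi> x = ip H x t"
proof -
  define F where "F = (\<lambda>x. (hnorm H x)\<^sup>2 - 2 * Re (\<phi> x))"
  define m where "m = (INF x\<in>vecs H. F x)"
  have Re_bound: "\<bar>Re (\<phi> x)\<bar> \<le> C * hnorm H x" if "x \<in> vecs H" for x
    using bound[OF that] abs_Re_le_cmod order_trans by blast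
  have "- (C\<^sup>2) \<le> F x" if "x \<in> vecs H" for x
  proof -
    have "0 \<le> (hnorm H x - C)\<^sup>2" by simp
    then show ?thesis using Re_bound[OF that] by (simp add: F_def power2_diff algebra_simps)
  qed
  then have bdd: "bdd_below (F ` vecs H)" by (auto simp: bdd_below_def)
  have m_le: "m \<le> F x" if "x \<in> vecs H" for x
    unfolding m_def using that bdd by (rule cINF_lower[rotated])
  have F_add: "F (x + y) = F x + 2 * (Re (ip H x y) - Re (\<phi> y)) + (hnorm H y)\<^sup>2"
    if "x \<in> vecs H" "y \<in> vecs H" for x y
    using that by (simp add: F_def hnorm_squared_add add)
  have "\<exists>x\<in>vecs H. F x < m + 1 / real (Suc k)" for k
    unfolding m_def using zero_vecs bdd by (intro iffD1[OF cINF_less_iff]) auto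
  then obtain s where s: "\<And>k. s k \<in> vecs H" "\<And>k. F (s k) < m + 1 / real (Suc k)" by metis
  have dist: "(hnorm H (x - y))\<^sup>2 \<le> 2 * (F x - m) + 2 * (F y - m)"
    if x: "x \<in> vecs H" and y: "y \<in> vecs H" for x y
  proof -
    \<comment> \<open>The parallelogram identity for \<open>F\<close>, with the midpoint \<open>z\<close> of \<open>x\<close> and \<open>y\<close>.\<close>
    define z where "z = smul H (1/2) (x + y)"
    have z: "z \<in> vecs H" unfolding z_def using x y by (intro smul_vecs add_vecs)
    have "(hnorm H z)\<^sup>2 = (hnorm H (x + y))\<^sup>2 / 4" "Re (\<phi> z) = (Re (\<phi> x) + Re (\<phi> y)) / 2"
      unfolding z_def using x y
      by (simp_all add: hnorm_smul add_vecs smul add power_mult_distrib norm_divide power2_eq_square)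
    then have "(hnorm H (x - y))\<^sup>2 = 2 * F x + 2 * F y - 4 * F z"
      using x y by (simp add: F_def hnorm_squared_add hnorm_squared_diff)
    moreover have "4 * m \<le> 4 * F z" using m_le[OF z] by simp
    ultimately show ?thesis by (simp add: algebra_simps)
  qed
  have "\<exists>l\<in>vecs H. (\<lambda>k. hnorm H (s k - l)) \<longlonglongrightarrow> 0"
  proof (rule complete[OF s(1)])
    fix e :: real assume "0 < e"
    then obtain N where N: "1 / real (Suc N) < e\<^sup>2 / 4"
      using reals_Archimedean[of "e\<^sup>2 / 4"] by (auto simp: inverse_eq_divide)
    have near: "F (s k) - m < e\<^sup>2 / 4" if "k \<ge> N" for k
    proof -
      have "1 / real (Suc k) \<le> 1 / real (Suc N)" using that by (simp add: field_simps)
      then show ?thesis using s(2)[of k] N by simp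
    qed
    have "hnorm H (s k - s j) < e" if "k \<ge> N" "j \<ge> N" for k j
    proof (rule power_less_imp_less_base[where n = 2])
      show "(hnorm H (s k - s j))\<^sup>2 < e\<^sup>2"
        using dist[OF s(1)[of k] s(1)[of j]] near[OF that(1)] near[OF that(2)] by argo
    qed (use \<open>0 < e\<close> in simp)
    then show "\<exists>N. \<forall>k\<ge>N. \<forall>j\<ge>N. hnorm H (s k - s j) < e" by blast
  qed
  then obtain l where l: "l \<in> vecs H" and lim: "(\<lambda>k. hnorm H (s k - l)) \<longlonglongrightarrow> 0" by blast
  have "F l \<le> m"
  proof (rule tendsto_lowerbound)
    have "(\<lambda>k. 2 * (hnorm H l + C) * hnorm H (s k - l)) \<longlonglongrightarrow> 0"
      using tendsto_mult_left[OF lim, of "2 * (hnorm H l + C)"] by simp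
    from tendsto_add[OF tendsto_add[OF tendsto_const[of m] LIMSEQ_inverse_real_of_nat] this]
    show "(\<lambda>k. m + 1 / real (Suc k) + 2 * (hnorm H l + C) * hnorm H (s k - l)) \<longlonglongrightarrow> m"
      by (simp add: inverse_eq_divide)
    have "F l \<le> m + 1 / real (Suc k) + 2 * (hnorm H l + C) * hnorm H (s k - l)" for k
    proof -
      have d: "s k - l \<in> vecs H" using s(1) l by (rule diff_vecs)
      have "\<bar>Re (ip H l (s k - l))\<bar> \<le> hnorm H l * hnorm H (s k - l)"
        using Cauchy_Schwarz[OF l d] abs_Re_le_cmod order_trans by blast
      moreover have "F (s k) = F l + 2 * (Re (ip H l (s k - l)) - Re (\<phi> (s k - l))) + (hnorm H (s k - l))\<^sup>2"
        using F_add[OF l d] by simp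
      moreover have "2 * (hnorm H l + C) * hnorm H (s k - l)
          = 2 * (hnorm H l * hnorm H (s k - l)) + 2 * (C * hnorm H (s k - l))"
        by (simp add: algebra_simps)
      ultimately show ?thesis
        using Re_bound[OF d] zero_le_power2[of "hnorm H (s k - l)"] s(2)[of k] by argo
    qed
    then show "\<forall>\<^sub>F k in sequentially.
        F l \<le> m + 1 / real (Suc k) + 2 * (hnorm H l + C) * hnorm H (s k - l)" by simp
  qed simp
  \<comment> \<open>At the minimum \<open>l\<close>, the derivative of \<open>F\<close> in every direction vanishes.\<close>
  have Re_eq: "Re (\<phi> y) = Re (ip H y l)" if y: "y \<in> vecs H" for y
  proof -
    have "0 \<le> 2 * t * (Re (ip H l y) - Re (\<phi> y)) + t\<^sup>2 * (hnorm H y)\<^sup>2" for t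
      using F_add[OF l smul_vecs[OF y, of "of_real t"]] m_le[OF add_vecs[OF l smul_vecs[OF y]]]
        \<open>F l \<le> m\<close> order_trans[OF \<open>F l \<le> m\<close> m_le[OF add_vecs[OF l smul_vecs[OF y, of "of_real t"]]]] l y
      by (simp add: ip_smul_right smul hnorm_smul power_mult_distrib algebra_simps)
    then have "Re (ip H l y) - Re (\<phi> y) = 0" by (rule linear_term_zero[rotated]) simp
    then show ?thesis using l y by (simp add: Re_ip_commute)
  qed
  have "\<phi> y = ip H y l" if y: "y \<in> vecs H" for y
  proof (rule complex_eqI)
    show "Im (\<phi> y) = Im (ip H y l)"
      using Re_eq[OF smul_vecs[OF y, of \<i>]] y l by (simp add: smul ip_smul_left)
  qed (rule Re_eq[OF y])
  then show ?thesis using l by blast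
qed

text \<open>
  Operators are constructed from forms: the adjoint product \<open>A* A\<close> and the weakly convergent
  series for its square root are both obtained in this way.
\<close>

lemma (in complex_hilbert_space) operator_of_bounded_form:
  assumes add_left: "\<And>x y z. \<lbrakk>x \<in> vecs H; y \<in> vecs H; z \<in> vecs H\<rbrakk> \<Longrightarrow> \<beta> (x + y) z = \<beta> x z + \<beta> y z"
    and smul_left: "\<And>c x z. \<lbrakk>x \<in> vecs H; z \<in> vecs H\<rbrakk> \<Longrightarrow> \<beta> (smul H c x) z = c * \<beta> x z"
    and add_right: "\<And>x y z. \<lbrakk>x \<in> vecs H; y \<in> vecs H; z \<in> vecs H\<rbrakk> \<Longrightarrow> \<beta> z (x + y) = \<beta> z x + \<beta> z y"
    and smul_right: "\<And>c x z. \<lbrakk>x \<in> vecs H; z \<in> vecs H\<rbrakk> \<Longrightarrow> \<beta> z (smul H c x) = cnj c * \<beta> z x"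
    and bound: "\<And>x z. \<lbrakk>x \<in> vecs H; z \<in> vecs H\<rbrakk> \<Longrightarrow> cmod (\<beta> x z) \<le> C * hnorm H x * hnorm H z"
  obtains T where "linear_map_between H H T"
    and "\<And>x z. \<lbrakk>x \<in> vecs H; z \<in> vecs H\<rbrakk> \<Longrightarrow> ip H (T x) z = \<beta> x z"
proof -
  have "\<exists>t\<in>vecs H. \<forall>z\<in>vecs H. cnj (\<beta> x z) = ip H z t" if "x \<in> vecs H" for x
    using that bound by (intro Riesz_representation[where C = "C * hnorm H x"])
      (simp_all add: add_right smul_right)
  then obtain T where T: "\<And>x. x \<in> vecs H \<Longrightarrow> T x \<in> vecs H"
    and cnj_\<beta>: "\<And>x z. \<lbrakk>x \<in> vecs H; z \<in> vecs H\<rbrakk> \<Longrightarrow> cnj (\<beta> x z) = ip H z (T x)" by metis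
  have ip_T: "ip H (T x) z = \<beta> x z" if "x \<in> vecs H" "z \<in> vecs H" for x z
    using cnj_\<beta>[OF that] ip_commute[of z "T x"] T that by (metis complex_cnj_cnj)
  have "linear_map_between H H T"
    unfolding linear_map_between_def
  proof (intro conjI ballI allI)
    show "T (x + y) = T x + T y" if "x \<in> vecs H" "y \<in> vecs H" for x y
      using that by (intro eq_if_ip_eq) (simp_all add: T add_vecs ip_T ip_add_left add_left)
    show "T (smul H c x) = smul H c (T x)" if "x \<in> vecs H" for c x
      using that by (intro eq_if_ip_eq) (simp_all add: T smul_vecs ip_T ip_smul_left smul_left)
  qed (use T in blast)
  then show thesis using ip_T by (rule that)
qed

section \<open>The power series of the square root\<close>

text \<open>
  The Taylor coefficients of \<open>(1 - t)\<^sup>1\<^sup>/\<^sup>2\<close>, which are \<open>(-1)\<^sup>k\<close> times the binomial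
  coefficients of \<open>1/2\<close>.
\<close>

definition sqrt_coeff :: "nat \<Rightarrow> real" where
  "sqrt_coeff k = pochhammer (-1/2) k / fact k"

lemma sqrt_coeff_0: "sqrt_coeff 0 = 1"
  by (simp add: sqrt_coeff_def)

lemma sqrt_coeff_Suc: "sqrt_coeff (Suc k) = sqrt_coeff k * ((real k - 1/2) / (real k + 1))"
  by (simp add: sqrt_coeff_def pochhammer_Suc field_simps)

lemma sqrt_coeff_nonpos: "sqrt_coeff (Suc k) \<le> 0"
proof (induction k)
  case (Suc k)
  show ?case
    unfolding sqrt_coeff_Suc[of "Suc k"] by (rule mult_nonpos_nonneg[OF Suc]) simp
qed (simp add: sqrt_coeff_Suc sqrt_coeff_0)

lemma sum_sqrt_coeff: "(\<Sum>k\<le>m. sqrt_coeff k) = pochhammer (1/2) m / fact m"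
proof (induction m)
  case (Suc m)
  define c where "c = 1 + real m"
  have "c \<noteq> 0" by (simp add: c_def)
  have "sqrt_coeff (Suc m) = - pochhammer (1/2) m / (2 * (c * fact m))"
    by (simp add: sqrt_coeff_def pochhammer_rec c_def)
  then have "(\<Sum>k\<le>Suc m. sqrt_coeff k)
      = pochhammer (1/2) m / fact m - pochhammer (1/2) m / (2 * (c * fact m))"
    using Suc by simp
  also have "\<dots> = pochhammer (1/2) m * (c - 1/2) / (c * fact m)"
    using \<open>c \<noteq> 0\<close> by (simp add: field_simps)
  also have "\<dots> = pochhammer (1/2) (Suc m) / fact (Suc m)"
    by (simp add: pochhammer_Suc c_def)
  finally show ?case .
qed (simp add: sqrt_coeff_0)

text \<open>
  All coefficients after the leading \<open>1\<close> are nonpositive, so the sum of the first absolute values is \<open>2\<close> minus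
  the partial sum of the coefficients, which \<open>sum_sqrt_coeff\<close> shows to be nonnegative. This is
  convergence up to the boundary \<open>t = 1\<close>, needed because \<open>A* A\<close> may have norm \<open>1\<close>.
\<close>

lemma abs_summable_sqrt_coeff: "(\<lambda>k. \<bar>sqrt_coeff k\<bar>) summable_on UNIV"
proof -
  have "(\<Sum>k\<le>m. norm (sqrt_coeff k)) \<le> 2" for m
  proof -
    have "(\<Sum>k\<le>m. norm (sqrt_coeff k)) = 2 - (\<Sum>k\<le>m. sqrt_coeff k)"
      by (induction m) (use sqrt_coeff_nonpos in \<open>simp_all add: sqrt_coeff_0\<close>)
    moreover have "0 \<le> (\<Sum>k\<le>m. sqrt_coeff k)"
      by (simp add: sum_sqrt_coeff pochhammer_nonneg)
    ultimately show ?thesis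
      by linarith
  qed
  then have "summable (\<lambda>k. norm (sqrt_coeff k))"
    by (intro bounded_imp_summable[where B = 2]) auto
  then show ?thesis by (simp add: summable_on_UNIV_nonneg_real_iff)
qed

text \<open>
  The square of the series is \<open>1 - t\<close>. This is Vandermonde's identity for rising factorials, at
  \<open>-1/2 + -1/2 = -1\<close>.
\<close>

lemma sqrt_coeff_convolution:
  "(\<Sum>k\<le>m. sqrt_coeff k * sqrt_coeff (m - k)) = (if m = 0 then 1 else if m = 1 then -1 else 0)"
proof -
  have "(\<Sum>k\<le>m. sqrt_coeff k * sqrt_coeff (m - k))
      = (\<Sum>k\<le>m. of_nat (m choose k) * pochhammer (-1/2) k * pochhammer (-1/2) (m - k) / fact m)"
    unfolding sqrt_coeff_def by (intro sum.cong) (simp_all add: binomial_fact field_simps)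
  also have "\<dots> = pochhammer (-1/2 + -1/2 :: real) m / fact m"
    by (simp only: pochhammer_binomial_sum sum_divide_distrib)
  also have "\<dots> = (if m = 0 then 1 else if m = 1 then -1 else 0)"
    by (cases m; cases "m - 1") (auto simp: pochhammer_rec)
  finally show ?thesis .
qed

text \<open>
  The identity \<open>((1 - t)\<^sup>1\<^sup>/\<^sup>2)\<^sup>2 = 1 - t\<close> with \<open>t\<^sup>k\<close> replaced by the \<open>k\<close>-th term of a bounded
  sequence. It will be applied to the moments \<open>b k = \<langle>B\<^sup>k x, x\<rangle>\<close>.
\<close>

lemma sqrt_series_squared:
  fixes b :: "nat \<Rightarrow> complex"
  assumes bound: "\<And>k. cmod (b k) \<le> M"
  shows "(\<Sum>\<^sub>\<infinity>k. of_real (sqrt_coeff k) * (\<Sum>\<^sub>\<infinity>j. of_real (sqrt_coeff j) * b (k + j))) = b 0 - b 1"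
proof -
  define F where "F = (\<lambda>k j. of_real (sqrt_coeff k) * (of_real (sqrt_coeff j) * b (k + j)))"
  have M: "0 \<le> M" using bound[of 0] norm_ge_zero order_trans by blast
  have "(\<lambda>(k, j). (\<bar>sqrt_coeff k\<bar> * \<bar>sqrt_coeff j\<bar>) * M) summable_on (UNIV \<times> UNIV)"
    using M abs_summable_sqrt_coeff
    by (intro summable_on_SigmaI[where g = "\<lambda>k. \<bar>sqrt_coeff k\<bar> * (\<Sum>\<^sub>\<infinity>j. \<bar>sqrt_coeff j\<bar>) * M"])
      (auto intro!: has_sum_cmult_left has_sum_cmult_right summable_on_cmult_left)
  then have "(\<lambda>p. norm (case p of (k, j) \<Rightarrow> F k j)) summable_on (UNIV \<times> UNIV)"
  proof (rule Infinite_Sum.abs_summable_on_comparison_test')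
    show "norm (case p of (k, j) \<Rightarrow> F k j) \<le> (case p of (k, j) \<Rightarrow> (\<bar>sqrt_coeff k\<bar> * \<bar>sqrt_coeff j\<bar>) * M)" for p
      using bound by (cases p) (auto simp: F_def norm_mult mult.assoc[symmetric] intro!: mult_left_mono)
  qed
  then have summable: "(\<lambda>(k, j). F k j) summable_on (UNIV \<times> UNIV)"
    by (rule abs_summable_summable)
  \<comment> \<open>Summation along the antidiagonals.\<close>
  have bij: "bij_betw (\<lambda>(m, k). (k, m - k)) (SIGMA m:UNIV. {..m}) (UNIV \<times> UNIV :: (nat \<times> nat) set)"
    by (rule bij_betw_byWitness[where f' = "\<lambda>(k, j). (k + j, k)"]) auto
  have "(\<Sum>\<^sub>\<infinity>k. of_real (sqrt_coeff k) * (\<Sum>\<^sub>\<infinity>j. of_real (sqrt_coeff j) * b (k + j)))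
      = (\<Sum>\<^sub>\<infinity>k. \<Sum>\<^sub>\<infinity>j. F k j)"
    by (simp add: F_def infsum_cmult_right')
  also have "\<dots> = (\<Sum>\<^sub>\<infinity>(k, j)\<in>UNIV \<times> UNIV. F k j)"
    using summable by (rule infsum_Sigma'_banach)
  also have "\<dots> = (\<Sum>\<^sub>\<infinity>(m, k)\<in>(SIGMA m:UNIV. {..m}). F k (m - k))"
    by (subst infsum_reindex_bij_betw[OF bij, symmetric]) (simp add: case_prod_unfold)
  also have "\<dots> = (\<Sum>\<^sub>\<infinity>m. \<Sum>\<^sub>\<infinity>k\<in>{..m}. F k (m - k))"
    using summable_on_reindex_bij_betw[OF bij, of "\<lambda>(k, j). F k j"] summable
    by (intro infsum_Sigma'_banach[symmetric]) (simp add: case_prod_unfold)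
  also have "\<dots> = (\<Sum>\<^sub>\<infinity>m. of_real (\<Sum>k\<le>m. sqrt_coeff k * sqrt_coeff (m - k)) * b m)"
    by (intro infsum_cong) (simp add: F_def sum_distrib_right mult.assoc)
  also have "\<dots> = b 0 - b 1"
    unfolding sqrt_coeff_convolution
    by (intro infsumI has_sum_finite_neutralI[where B = "{0, 1}"]) auto
  finally show ?thesis .
qed

section \<open>The defect operator of a contraction\<close>

context complex_hilbert_space
begin

lemma linear_map_facts:
  assumes "linear_map_between H H T"
  shows linear_map_vecs: "x \<in> vecs H \<Longrightarrow> T x \<in> vecs H"
    and linear_map_add: "\<lbrakk>x \<in> vecs H; y \<in> vecs H\<rbrakk> \<Longrightarrow> T (x + y) = T x + T y"
    and linear_map_smul: "x \<in> vecs H \<Longrightarrow> T (smul H c x) = smul H c (T x)"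
  using assms by (auto simp: linear_map_between_def)

lemma contraction_linear: "contraction H T \<Longrightarrow> linear_map_between H H T"
  by (simp add: contraction_def)

lemma contraction_ip_bound:
  assumes "contraction H T" "x \<in> vecs H" "y \<in> vecs H"
  shows "cmod (ip H (T x) y) \<le> hnorm H x * hnorm H y"
proof -
  have "cmod (ip H (T x) y) \<le> hnorm H (T x) * hnorm H y"
    using assms by (simp add: Cauchy_Schwarz contraction_def linear_map_vecs)
  also have "\<dots> \<le> hnorm H x * hnorm H y"
    using assms by (intro mult_right_mono hnorm_nonneg) (auto simp: contraction_def)
  finally show ?thesis .
qed

lemma contraction_funpow:
  assumes "contraction H T"
  shows "contraction H (T ^^ k)"
proof (induction k)
  case (Suc k)
  note T = contraction_linear[OF assms] and Tk = contraction_linear[OF Suc]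
  have "T ((T ^^ k) (x + y)) = T ((T ^^ k) x) + T ((T ^^ k) y)" if "x \<in> vecs H" "y \<in> vecs H" for x y
    using that by (simp add: linear_map_add[OF Tk] linear_map_add[OF T] linear_map_vecs[OF Tk])
  moreover have "T ((T ^^ k) (smul H c x)) = smul H c (T ((T ^^ k) x))" if "x \<in> vecs H" for c x
    using that by (simp add: linear_map_smul[OF Tk] linear_map_smul[OF T] linear_map_vecs[OF Tk])
  moreover have "T ((T ^^ k) x) \<in> vecs H" if "x \<in> vecs H" for x
    using that by (intro linear_map_vecs[OF T] linear_map_vecs[OF Tk])
  moreover have "hnorm H (T ((T ^^ k) x)) \<le> hnorm H x" if "x \<in> vecs H" for x
  proof -
    have "hnorm H (T ((T ^^ k) x)) \<le> hnorm H ((T ^^ k) x)"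
      using assms linear_map_vecs[OF Tk that] by (simp add: contraction_def)
    also have "\<dots> \<le> hnorm H x" using Suc that by (simp add: contraction_def)
    finally show ?thesis .
  qed
  ultimately show ?case by (simp add: contraction_def linear_map_between_def)
qed (simp add: contraction_def linear_map_between_def)

text \<open>
  The operator \<open>D = (I - B)\<^sup>1\<^sup>/\<^sup>2\<close> is determined by its matrix coefficients \<open>\<langle>D x, y\<rangle>\<close>, which are the
  scalar series in the second conclusion. The identity \<open>D\<^sup>2 = I - B\<close> appears
  in the form \<open>\<parallel>D x\<parallel>\<^sup>2 = \<langle>x, x\<rangle> - \<langle>B x, x\<rangle>\<close>. Inserting the series in both arguments of
  \<open>\<langle>D x, D x\<rangle>\<close> gives a double series in the moments \<open>\<langle>B\<^sup>k\<^sup>+\<^sup>j x, x\<rangle>\<close>. The series is part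
  of the conclusion because commutation properties of \<open>B\<close> pass to \<open>D\<close> through it.
\<close>

lemma sqrt_one_minus:
  assumes B: "contraction H B"
    and selfadj: "\<And>x y. \<lbrakk>x \<in> vecs H; y \<in> vecs H\<rbrakk> \<Longrightarrow> ip H (B x) y = ip H x (B y)"
  obtains D where "linear_map_between H H D"
    and "\<And>x y. \<lbrakk>x \<in> vecs H; y \<in> vecs H\<rbrakk> \<Longrightarrow>
            ip H (D x) y = (\<Sum>\<^sub>\<infinity>k. of_real (sqrt_coeff k) * ip H ((B ^^ k) x) y)"
    and "\<And>x. x \<in> vecs H \<Longrightarrow> ip H (D x) (D x) = ip H x x - ip H (B x) x"
proof -
  define \<tau> where "\<tau> = (\<lambda>x y k. of_real (sqrt_coeff k) * ip H ((B ^^ k) x) y)"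
  define \<beta> where "\<beta> = (\<lambda>x y. infsum (\<tau> x y) UNIV)"
  define C where "C = (\<Sum>\<^sub>\<infinity>k. \<bar>sqrt_coeff k\<bar>)"
  note Bk = contraction_funpow[OF B]
  note Bk_linear = contraction_linear[OF Bk]
  have \<tau>_bound: "cmod (\<tau> x y k) \<le> \<bar>sqrt_coeff k\<bar> * (hnorm H x * hnorm H y)"
    if "x \<in> vecs H" "y \<in> vecs H" for x y k
    using contraction_ip_bound[OF Bk that, of k] by (simp add: \<tau>_def norm_mult mult_left_mono)
  have majorant: "(\<lambda>k. \<bar>sqrt_coeff k\<bar> * (hnorm H x * hnorm H y)) summable_on UNIV" for x y
    by (intro summable_on_cmult_left abs_summable_sqrt_coeff)
  have abs_summable: "(\<lambda>k. cmod (\<tau> x y k)) summable_on UNIV"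
    if "x \<in> vecs H" "y \<in> vecs H" for x y
    by (rule Infinite_Sum.abs_summable_on_comparison_test'[OF majorant]) (rule \<tau>_bound[OF that])
  have summable: "\<tau> x y summable_on UNIV" if "x \<in> vecs H" "y \<in> vecs H" for x y
    by (rule abs_summable_summable) (rule abs_summable[OF that])
  have bound: "cmod (\<beta> x y) \<le> C * hnorm H x * hnorm H y" if "x \<in> vecs H" "y \<in> vecs H" for x y
  proof -
    have "cmod (\<beta> x y) \<le> (\<Sum>\<^sub>\<infinity>k. cmod (\<tau> x y k))"
      unfolding \<beta>_def by (rule norm_infsum_bound) (rule abs_summable[OF that])
    also have "\<dots> \<le> (\<Sum>\<^sub>\<infinity>k. \<bar>sqrt_coeff k\<bar> * (hnorm H x * hnorm H y))"
      by (rule infsum_mono) (simp_all only: abs_summable[OF that] majorant \<tau>_bound[OF that])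
    also have "\<dots> = C * (hnorm H x * hnorm H y)"
      unfolding C_def by (rule infsum_cmult_left')
    finally show ?thesis by (simp only: mult.assoc)
  qed
  have add_left: "\<beta> (x + y) z = \<beta> x z + \<beta> y z" if "x \<in> vecs H" "y \<in> vecs H" "z \<in> vecs H" for x y z
  proof -
    have "\<tau> (x + y) z = (\<lambda>k. \<tau> x z k + \<tau> y z k)"
      using that by (simp add: \<tau>_def fun_eq_iff linear_map_add[OF Bk_linear]
          linear_map_vecs[OF Bk_linear] ip_add_left distrib_left)
    then show ?thesis unfolding \<beta>_def using infsum_add[OF summable[OF that(1,3)] summable[OF that(2,3)]] by simp
  qed
  have add_right: "\<beta> z (x + y) = \<beta> z x + \<beta> z y" if "x \<in> vecs H" "y \<in> vecs H" "z \<in> vecs H" for x y z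
  proof -
    have "\<tau> z (x + y) = (\<lambda>k. \<tau> z x k + \<tau> z y k)"
      using that by (simp add: \<tau>_def fun_eq_iff linear_map_vecs[OF Bk_linear] ip_add_right distrib_left)
    then show ?thesis unfolding \<beta>_def using infsum_add[OF summable[OF that(3,1)] summable[OF that(3,2)]] by simp
  qed
  have smul_left: "\<beta> (smul H c x) z = c * \<beta> x z" if "x \<in> vecs H" "z \<in> vecs H" for c x z
  proof -
    have "\<tau> (smul H c x) z = (\<lambda>k. c * \<tau> x z k)"
      using that by (simp add: \<tau>_def fun_eq_iff linear_map_smul[OF Bk_linear]
          linear_map_vecs[OF Bk_linear] ip_smul_left)
    then show ?thesis unfolding \<beta>_def by (simp only: infsum_cmult_right')
  qed
  have smul_right: "\<beta> z (smul H c x) = cnj c * \<beta> z x" if "x \<in> vecs H" "z \<in> vecs H" for c x z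
  proof -
    have "\<tau> z (smul H c x) = (\<lambda>k. cnj c * \<tau> z x k)"
      using that by (simp add: \<tau>_def fun_eq_iff linear_map_vecs[OF Bk_linear] ip_smul_right)
    then show ?thesis unfolding \<beta>_def by (simp only: infsum_cmult_right')
  qed
  obtain D where D: "linear_map_between H H D"
    and ip_D: "\<And>x y. \<lbrakk>x \<in> vecs H; y \<in> vecs H\<rbrakk> \<Longrightarrow> ip H (D x) y = \<beta> x y"
    using operator_of_bounded_form[OF add_left smul_left add_right smul_right bound] by blast
  have ip_D_series: "ip H (D x) y = (\<Sum>\<^sub>\<infinity>k. of_real (sqrt_coeff k) * ip H ((B ^^ k) x) y)"
    if "x \<in> vecs H" "y \<in> vecs H" for x y
    using ip_D[OF that] by (simp add: \<beta>_def \<tau>_def)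
  have Bk_selfadj: "ip H ((B ^^ k) x) y = ip H x ((B ^^ k) y)"
    if "x \<in> vecs H" "y \<in> vecs H" for x y k
    using that
  proof (induction k arbitrary: y)
    case (Suc k)
    then have "ip H ((B ^^ Suc k) x) y = ip H x ((B ^^ k) (B y))"
      by (simp add: selfadj linear_map_vecs[OF Bk_linear] linear_map_vecs[OF contraction_linear[OF B]])
    then show ?case by (simp add: funpow_swap1)
  qed simp
  have "ip H (D x) (D x) = ip H x x - ip H (B x) x" if x: "x \<in> vecs H" for x
  proof -
    have Dx: "D x \<in> vecs H" by (rule linear_map_vecs[OF D x])
    have moments: "ip H ((B ^^ k) x) (D x) = (\<Sum>\<^sub>\<infinity>j. of_real (sqrt_coeff j) * ip H ((B ^^ (k + j)) x) x)"
      for k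
    proof -
      have Bkx: "(B ^^ k) x \<in> vecs H" by (rule linear_map_vecs[OF Bk_linear x])
      have "ip H ((B ^^ k) x) (D x) = cnj (\<Sum>\<^sub>\<infinity>j. of_real (sqrt_coeff j) * ip H ((B ^^ j) x) ((B ^^ k) x))"
        using ip_commute[OF Dx Bkx] ip_D_series[OF x Bkx] by simp
      also have "\<dots> = (\<Sum>\<^sub>\<infinity>j. of_real (sqrt_coeff j) * cnj (ip H ((B ^^ j) x) ((B ^^ k) x)))"
        by (simp flip: infsum_cnj)
      also have "\<dots> = (\<Sum>\<^sub>\<infinity>j. of_real (sqrt_coeff j) * ip H ((B ^^ (k + j)) x) x)"
      proof (intro infsum_cong arg_cong2[where f = "(*)"] refl)
        fix j
        have "cnj (ip H ((B ^^ j) x) ((B ^^ k) x)) = ip H ((B ^^ k) x) ((B ^^ j) x)"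
          using x by (intro ip_commute[symmetric]) (simp_all add: linear_map_vecs[OF Bk_linear])
        also have "\<dots> = ip H ((B ^^ j) ((B ^^ k) x)) x"
          using x by (simp add: Bk_selfadj linear_map_vecs[OF Bk_linear])
        also have "(B ^^ j) ((B ^^ k) x) = (B ^^ (k + j)) x"
          by (simp add: funpow_add add.commute[of k j])
        finally show "cnj (ip H ((B ^^ j) x) ((B ^^ k) x)) = ip H ((B ^^ (k + j)) x) x" .
      qed
      finally show ?thesis .
    qed
    have "ip H (D x) (D x) = (\<Sum>\<^sub>\<infinity>k. of_real (sqrt_coeff k)
        * (\<Sum>\<^sub>\<infinity>j. of_real (sqrt_coeff j) * ip H ((B ^^ (k + j)) x) x))"
      using ip_D_series[OF x Dx] by (simp add: moments)
    also have "\<dots> = ip H ((B ^^ 0) x) x - ip H ((B ^^ 1) x) x"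
      by (rule sqrt_series_squared[OF contraction_ip_bound[OF Bk x x]])
    finally show ?thesis by simp
  qed
  with D ip_D_series show thesis by (rule that)
qed

text \<open>
  The last conclusion says that \<open>D\<close> commutes with every \<open>P\<close> for which \<open>A* A P = P A* A\<close>, written without
  adjoints: \<open>Q\<close> is the adjoint of \<open>P\<close>, and the hypothesis on \<open>A\<close> is the equality of
  \<open>\<langle>A* A P x, y\<rangle>\<close> and \<open>\<langle>P A* A x, y\<rangle>\<close>. The operator \<open>B\<close> in the proof is \<open>A* A\<close>.
\<close>

lemma defect_operator:
  assumes A: "contraction H A"
  obtains D where "linear_map_between H H D"
    and "\<And>x. x \<in> vecs H \<Longrightarrow> (hnorm H (A x))\<^sup>2 + (hnorm H (D x))\<^sup>2 = (hnorm H x)\<^sup>2"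
    and "\<And>P Q x. \<lbrakk>\<And>x. x \<in> vecs H \<Longrightarrow> P x \<in> vecs H; \<And>x. x \<in> vecs H \<Longrightarrow> Q x \<in> vecs H;
            \<And>x y. \<lbrakk>x \<in> vecs H; y \<in> vecs H\<rbrakk> \<Longrightarrow> ip H (P x) y = ip H x (Q y);
            \<And>x y. \<lbrakk>x \<in> vecs H; y \<in> vecs H\<rbrakk> \<Longrightarrow> ip H (A (P x)) (A y) = ip H (A x) (A (Q y));
            x \<in> vecs H\<rbrakk> \<Longrightarrow> D (P x) = P (D x)"
proof -
  note A_linear = contraction_linear[OF A]
  have A_bound: "cmod (ip H (A x) (A y)) \<le> 1 * hnorm H x * hnorm H y"
    if "x \<in> vecs H" "y \<in> vecs H" for x y
  proof -
    have "hnorm H x * hnorm H (A y) \<le> hnorm H x * hnorm H y"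
      using A that by (intro mult_left_mono) (auto simp: contraction_def hnorm_nonneg)
    then show ?thesis
      using contraction_ip_bound[OF A that(1) linear_map_vecs[OF A_linear that(2)]] by simp
  qed
  obtain B where B_linear: "linear_map_between H H B"
    and ip_B: "\<And>x y. \<lbrakk>x \<in> vecs H; y \<in> vecs H\<rbrakk> \<Longrightarrow> ip H (B x) y = ip H (A x) (A y)"
    by (rule operator_of_bounded_form[of "\<lambda>x y. ip H (A x) (A y)" 1])
      (use A_bound in \<open>auto simp: linear_map_facts[OF A_linear] ip_add_left ip_add_right
        ip_smul_left ip_smul_right\<close>)
  note A_vecs = linear_map_vecs[OF A_linear] and B_vecs = linear_map_vecs[OF B_linear]
  have B: "contraction H B"
    unfolding contraction_def
  proof (intro conjI ballI B_linear)
    fix x assume x: "x \<in> vecs H"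
    have "hnorm H (B x) * hnorm H (B x) = cmod (ip H (B x) (B x))"
      using x by (simp add: ip_self B_vecs norm_power power2_eq_square norm_mult)
    also have "\<dots> \<le> hnorm H x * hnorm H (B x)"
      using A_bound[OF x B_vecs[OF x]] x by (simp add: ip_B B_vecs)
    finally show "hnorm H (B x) \<le> hnorm H x"
      using x hnorm_nonneg[of x] hnorm_nonneg[OF B_vecs[OF x]]
      by (metis mult_right_le_imp_le order_le_less)
  qed
  have selfadj: "ip H (B x) y = ip H x (B y)" if "x \<in> vecs H" "y \<in> vecs H" for x y
    using that ip_commute[of "B y" x] ip_commute[of "A y" "A x"] by (simp add: ip_B A_vecs B_vecs)
  obtain D where D: "linear_map_between H H D"
    and series: "\<And>x y. \<lbrakk>x \<in> vecs H; y \<in> vecs H\<rbrakk> \<Longrightarrow>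
          ip H (D x) y = (\<Sum>\<^sub>\<infinity>k. of_real (sqrt_coeff k) * ip H ((B ^^ k) x) y)"
    and square: "\<And>x. x \<in> vecs H \<Longrightarrow> ip H (D x) (D x) = ip H x x - ip H (B x) x"
    using sqrt_one_minus[OF B selfadj] by blast
  have isometric: "(hnorm H (A x))\<^sup>2 + (hnorm H (D x))\<^sup>2 = (hnorm H x)\<^sup>2" if x: "x \<in> vecs H" for x
    using square[OF x] x by (simp add: hnorm_squared ip_B A_vecs linear_map_vecs[OF D])
  have commutes: "D (P x) = P (D x)"
    if P: "\<And>x. x \<in> vecs H \<Longrightarrow> P x \<in> vecs H" and Q: "\<And>x. x \<in> vecs H \<Longrightarrow> Q x \<in> vecs H"
      and adj: "\<And>x y. \<lbrakk>x \<in> vecs H; y \<in> vecs H\<rbrakk> \<Longrightarrow> ip H (P x) y = ip H x (Q y)"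
      and A_adj: "\<And>x y. \<lbrakk>x \<in> vecs H; y \<in> vecs H\<rbrakk> \<Longrightarrow> ip H (A (P x)) (A y) = ip H (A x) (A (Q y))"
      and x: "x \<in> vecs H" for P Q x
  proof -
    have BP: "B (P x) = P (B x)" if "x \<in> vecs H" for x
      using that by (intro eq_if_ip_eq) (simp_all add: B_vecs P Q ip_B adj A_adj)
    have Bk: "(B ^^ k) x \<in> vecs H \<and> (B ^^ k) (P x) = P ((B ^^ k) x)" for k
      by (induction k) (use x in \<open>simp_all add: BP B_vecs\<close>)
    show ?thesis
    proof (rule eq_if_ip_eq)
      fix z assume z: "z \<in> vecs H"
      have "ip H (D (P x)) z = (\<Sum>\<^sub>\<infinity>k. of_real (sqrt_coeff k) * ip H ((B ^^ k) x) (Q z))"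
        using x z Bk by (simp add: series P adj)
      also have "\<dots> = ip H (P (D x)) z"
        using x z by (simp add: series Q adj linear_map_vecs[OF D])
      finally show "ip H (D (P x)) z = ip H (P (D x)) z" .
    qed (use x in \<open>simp_all add: P linear_map_vecs[OF D]\<close>)
  qed
  show thesis by (rule that[OF D isometric commutes])
qed

end

section \<open>Square-summable families of vectors\<close>

definition l2_space :: "'v inner_space \<Rightarrow> ('i \<Rightarrow> 'v::ab_group_add) inner_space" where
  "l2_space H = \<lparr>
     vecs = {k. (\<forall>w. k w \<in> vecs H) \<and> (\<lambda>w. (hnorm H (k w))\<^sup>2) summable_on UNIV},
     smul = (\<lambda>c k w. smul H c (k w)),
     ip = (\<lambda>k l. \<Sum>\<^sub>\<infinity>w. ip H (k w) (l w))\<rparr>"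

lemma smul_l2 [simp]: "smul (l2_space H) c k = (\<lambda>w. smul H c (k w))"
  by (simp add: l2_space_def)

lemma ip_l2: "ip (l2_space H) k l = (\<Sum>\<^sub>\<infinity>w. ip H (k w) (l w))"
  by (simp add: l2_space_def)

lemma l2_vecs_iff:
  "k \<in> vecs (l2_space H) \<longleftrightarrow> (\<forall>w. k w \<in> vecs H) \<and> (\<lambda>w. (hnorm H (k w))\<^sup>2) summable_on UNIV"
  by (simp add: l2_space_def)

lemma l2_component: "k \<in> vecs (l2_space H) \<Longrightarrow> k w \<in> vecs H"
  by (simp add: l2_vecs_iff)

lemma l2_summable: "k \<in> vecs (l2_space H) \<Longrightarrow> (\<lambda>w. (hnorm H (k w))\<^sup>2) summable_on UNIV"
  by (simp add: l2_vecs_iff)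

context complex_inner_space
begin

lemma l2_ip_summable:
  assumes "k \<in> vecs (l2_space H)" "l \<in> vecs (l2_space H)"
  shows "(\<lambda>w. ip H (k w) (l w)) summable_on UNIV"
proof -
  have "(\<lambda>w. (hnorm H (k w))\<^sup>2 + (hnorm H (l w))\<^sup>2) summable_on UNIV"
    using assms by (intro summable_on_add l2_summable)
  then have "(\<lambda>w. norm (ip H (k w) (l w))) summable_on UNIV"
    by (rule Infinite_Sum.abs_summable_on_comparison_test')
      (use assms in \<open>simp add: cmod_ip_le l2_component\<close>)
  then show ?thesis by (rule abs_summable_summable)
qed

lemma l2_ip_self:
  assumes "k \<in> vecs (l2_space H)"
  shows "ip (l2_space H) k k = of_real (\<Sum>\<^sub>\<infinity>w. (hnorm H (k w))\<^sup>2)"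
proof -
  have "((\<lambda>w. of_real ((hnorm H (k w))\<^sup>2)) has_sum
      (of_real (\<Sum>\<^sub>\<infinity>w. (hnorm H (k w))\<^sup>2) :: complex)) UNIV"
    by (intro has_sum_of_real has_sum_infsum l2_summable assms)
  then show ?thesis
    using assms by (simp add: ip_l2 ip_self l2_component infsumI del: of_real_power)
qed

lemma l2_hnorm_squared:
  assumes "k \<in> vecs (l2_space H)"
  shows "(hnorm (l2_space H) k)\<^sup>2 = (\<Sum>\<^sub>\<infinity>w. (hnorm H (k w))\<^sup>2)"
  using l2_ip_self[OF assms] by (simp add: hnorm_def[of "l2_space H"] infsum_nonneg)

lemma l2_norm_has_sum:
  assumes "k \<in> vecs (l2_space H)"
  shows "((\<lambda>w. (hnorm H (k w))\<^sup>2) has_sum (hnorm (l2_space H) k)\<^sup>2) UNIV"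
  using l2_summable[OF assms] by (simp add: l2_hnorm_squared[OF assms])

text \<open>
  Membership and norm at once, for families whose squared norms have a known sum; this is how the
  isometry of \<open>H\<close> into \<open>K\<close> and of the dilation are verified.
\<close>

lemma l2_hnorm_eq:
  assumes "0 \<le> c" and "((\<lambda>w. (hnorm H (k w))\<^sup>2) has_sum c\<^sup>2) UNIV" and "\<And>w. k w \<in> vecs H"
  shows "k \<in> vecs (l2_space H)" "hnorm (l2_space H) k = c"
proof -
  show k: "k \<in> vecs (l2_space H)"
    using assms by (auto simp: l2_vecs_iff summable_on_def)
  show "hnorm (l2_space H) k = c"
    using assms(1) infsumI[OF assms(2)] l2_ip_self[OF k] by (simp add: hnorm_def[of "l2_space H"])
qed

lemma l2_sum_le_hnorm_squared:
  assumes "k \<in> vecs (l2_space H)" "finite F"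
  shows "(\<Sum>w\<in>F. (hnorm H (k w))\<^sup>2) \<le> (hnorm (l2_space H) k)\<^sup>2"
  using assms by (simp add: l2_hnorm_squared finite_sum_le_infsum l2_summable)

lemma l2_bounded_sums:
  assumes "\<And>w. k w \<in> vecs H" "0 \<le> c" "\<And>F. finite F \<Longrightarrow> (\<Sum>w\<in>F. (hnorm H (k w))\<^sup>2) \<le> c\<^sup>2"
  shows "k \<in> vecs (l2_space H)" "hnorm (l2_space H) k \<le> c"
proof -
  have "(\<lambda>w. (hnorm H (k w))\<^sup>2) summable_on UNIV"
    using assms(3) by (intro nonneg_bdd_above_summable_on) (auto simp: bdd_above_def)
  then show k: "k \<in> vecs (l2_space H)" using assms(1) by (simp add: l2_vecs_iff)
  have "(hnorm (l2_space H) k)\<^sup>2 \<le> c\<^sup>2"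
    unfolding l2_hnorm_squared[OF k] using assms(3) by (intro infsum_le_finite_sums l2_summable[OF k])
  then show "hnorm (l2_space H) k \<le> c" using assms(2) by (rule power2_le_imp_le)
qed

lemma l2_add_vecs:
  assumes k: "k \<in> vecs (l2_space H)" and l: "l \<in> vecs (l2_space H)"
  shows "k + l \<in> vecs (l2_space H)"
proof -
  have "(\<lambda>w. 2 * ((hnorm H (k w))\<^sup>2 + (hnorm H (l w))\<^sup>2)) summable_on UNIV"
    by (intro summable_on_cmult_right summable_on_add l2_summable assms)
  then have "(\<lambda>w. (hnorm H (k w + l w))\<^sup>2) summable_on UNIV"
    by (rule summable_on_comparison_test)
      (use hnorm_squared_add_le[OF l2_component[OF k] l2_component[OF l]] in simp_all)
  then show ?thesis
    by (simp add: l2_vecs_iff add_vecs l2_component[OF k] l2_component[OF l])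
qed

lemma l2_smul_vecs:
  assumes k: "k \<in> vecs (l2_space H)"
  shows "(\<lambda>w. smul H c (k w)) \<in> vecs (l2_space H)"
  using assms
  by (simp add: l2_vecs_iff smul_vecs hnorm_smul power_mult_distrib summable_on_cmult_right)

lemma l2_inner_space: "complex_inner_space (l2_space H :: ('i \<Rightarrow> 'v) inner_space)"
proof (rule complex_inner_space.intro)
  let ?L = "l2_space H :: ('i \<Rightarrow> 'v) inner_space"
  show ambient: "vector_space (smul ?L)"
    by unfold_locales (simp_all add: fun_eq_iff smul_add smul_add_left smul_smul smul_one)
  interpret L: vector_space "smul ?L" by (rule ambient)
  have "0 \<in> vecs ?L" by (simp add: l2_vecs_iff zero_vecs hnorm_zero)
  then show "module.subspace (smul ?L) (vecs ?L)"
    by (simp add: L.subspace_def l2_add_vecs l2_smul_vecs)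
next
  fix x y z :: "'i \<Rightarrow> 'v"
  assume x: "x \<in> vecs (l2_space H)" and y: "y \<in> vecs (l2_space H)" and z: "z \<in> vecs (l2_space H)"
  show "ip (l2_space H) (x + y) z = ip (l2_space H) x z + ip (l2_space H) y z"
    using infsum_add[OF l2_ip_summable[OF x z] l2_ip_summable[OF y z]]
    by (simp add: ip_l2 ip_add_left l2_component[OF x] l2_component[OF y] l2_component[OF z])
next
  fix x z :: "'i \<Rightarrow> 'v" and c
  assume x: "x \<in> vecs (l2_space H)" and z: "z \<in> vecs (l2_space H)"
  show "ip (l2_space H) (smul (l2_space H) c x) z = c * ip (l2_space H) x z"
    by (simp add: ip_l2 ip_smul_left l2_component[OF x] l2_component[OF z] infsum_cmult_right')
next
  fix x y :: "'i \<Rightarrow> 'v"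
  assume x: "x \<in> vecs (l2_space H)" and y: "y \<in> vecs (l2_space H)"
  have "ip H (y w) (x w) = cnj (ip H (x w) (y w))" for w
    using x y by (simp add: ip_commute[of "x w"] l2_component)
  then show "ip (l2_space H) y x = cnj (ip (l2_space H) x y)"
    by (simp only: ip_l2 infsum_cnj)
next
  fix x :: "'i \<Rightarrow> 'v"
  assume x: "x \<in> vecs (l2_space H)" and "x \<noteq> 0"
  then obtain w where w: "x w \<noteq> 0" by (auto simp: fun_eq_iff)
  have "0 < (hnorm H (x w))\<^sup>2" using w by (simp add: hnorm_eq_0_iff l2_component[OF x])
  also have "\<dots> \<le> (hnorm (l2_space H) x)\<^sup>2" using l2_sum_le_hnorm_squared[OF x, of "{w}"] by simp
  also have "\<dots> = Re (ip (l2_space H) x x)"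
    by (simp add: l2_ip_self[OF x] l2_hnorm_squared[OF x])
  finally show "0 < Re (ip (l2_space H) x x)" .
qed

lemma hnorm_tendsto:
  assumes "\<And>k. s k \<in> vecs H" "l \<in> vecs H" "y \<in> vecs H" "(\<lambda>k. hnorm H (s k - l)) \<longlonglongrightarrow> 0"
  shows "(\<lambda>k. hnorm H (y - s k)) \<longlonglongrightarrow> hnorm H (y - l)"
proof -
  have triangle: "\<bar>hnorm H (y - s k) - hnorm H (y - l)\<bar> \<le> hnorm H (s k - l)" for k
  proof -
    have "hnorm H (y - l) \<le> hnorm H (y - s k) + hnorm H (s k - l)"
      using hnorm_triangle[of "y - s k" "s k - l"] assms by (simp add: diff_vecs)
    moreover have "hnorm H (y - s k) \<le> hnorm H (y - l) + hnorm H (s k - l)"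
      using hnorm_triangle[of "y - l" "l - s k"] hnorm_smul[of "s k - l" "-1"] assms
      by (simp add: diff_vecs smul_minus_one)
    ultimately show ?thesis by linarith
  qed
  have "(\<lambda>k. hnorm H (y - s k) - hnorm H (y - l)) \<longlonglongrightarrow> 0"
    by (rule tendsto_0_le[OF assms(4), of _ 1]) (use triangle in \<open>simp add: hnorm_nonneg assms diff_vecs\<close>)
  then show ?thesis by (rule LIM_zero_cancel)
qed

end

text \<open>
  A Cauchy sequence converges in every component. On a finite set of components limit and sum commute;
  letting one index of the Cauchy estimate tend to infinity there bounds the distance to the
  componentwise limit.
\<close>

lemma (in complex_hilbert_space) l2_hilbert_space:
  "complex_hilbert_space (l2_space H :: ('i \<Rightarrow> 'a) inner_space)"
proof -
  interpret L: complex_inner_space "l2_space H :: ('i \<Rightarrow> 'a) inner_space" by (rule l2_inner_space)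
  let ?L = "l2_space H :: ('i \<Rightarrow> 'a) inner_space"
  show ?thesis
  proof
    fix s :: "nat \<Rightarrow> 'i \<Rightarrow> 'a"
    assume s: "\<And>k. s k \<in> vecs ?L"
      and Cauchy: "\<And>e. 0 < e \<Longrightarrow> \<exists>N. \<forall>k\<ge>N. \<forall>m\<ge>N. hnorm ?L (s k - s m) < e"
    have s_vecs: "s k w \<in> vecs H" for k w using s by (rule l2_component)
    have le: "hnorm H (s k w - s m w) \<le> hnorm ?L (s k - s m)" for k m w
      using l2_sum_le_hnorm_squared[OF L.diff_vecs[OF s s], of "{w}" k m] L.hnorm_nonneg[OF L.diff_vecs[OF s s]]
      by (auto intro: power2_le_imp_le)
    have "\<exists>l\<in>vecs H. (\<lambda>k. hnorm H (s k w - l)) \<longlonglongrightarrow> 0" for w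
    proof (rule complete[OF s_vecs])
      fix e :: real assume "0 < e"
      then show "\<exists>N. \<forall>k\<ge>N. \<forall>m\<ge>N. hnorm H (s k w - s m w) < e"
        using Cauchy[of e] le le_less_trans by meson
    qed
    then obtain l where l: "\<And>w. l w \<in> vecs H"
      and lim: "\<And>w. (\<lambda>k. hnorm H (s k w - l w)) \<longlonglongrightarrow> 0" by metis
    have close: "s k - l \<in> vecs ?L \<and> hnorm ?L (s k - l) \<le> e"
      if N: "\<forall>k\<ge>N. \<forall>m\<ge>N. hnorm ?L (s k - s m) < e" and "0 < e" and k: "k \<ge> N" for N e k
    proof -
      have "(\<Sum>w\<in>F. (hnorm H ((s k - l) w))\<^sup>2) \<le> e\<^sup>2" if "finite F" for F
      proof (rule tendsto_upperbound)
        show "(\<lambda>m. \<Sum>w\<in>F. (hnorm H (s k w - s m w))\<^sup>2) \<longlonglongrightarrow> (\<Sum>w\<in>F. (hnorm H ((s k - l) w))\<^sup>2)"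
          by (simp, intro tendsto_sum tendsto_power hnorm_tendsto) (simp_all add: s_vecs l lim)
        have "(\<Sum>w\<in>F. (hnorm H (s k w - s m w))\<^sup>2) \<le> e\<^sup>2" if "m \<ge> N" for m
        proof -
          have "(\<Sum>w\<in>F. (hnorm H (s k w - s m w))\<^sup>2) \<le> (hnorm ?L (s k - s m))\<^sup>2"
            using l2_sum_le_hnorm_squared[OF L.diff_vecs[OF s s] \<open>finite F\<close>, of k m] by simp
          also have "\<dots> \<le> e\<^sup>2"
            using N k that by (intro power_mono L.hnorm_nonneg L.diff_vecs s) (simp add: less_imp_le)
          finally show ?thesis .
        qed
        then show "\<forall>\<^sub>F m in sequentially. (\<Sum>w\<in>F. (hnorm H (s k w - s m w))\<^sup>2) \<le> e\<^sup>2"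
          by (auto simp: eventually_sequentially)
      qed simp
      then show ?thesis
        using l2_bounded_sums[of "s k - l" e] \<open>0 < e\<close> by (simp add: diff_vecs s_vecs l)
    qed
    have "l \<in> vecs ?L"
    proof -
      obtain N where "\<forall>k\<ge>N. \<forall>m\<ge>N. hnorm ?L (s k - s m) < 1" using Cauchy[of 1] by auto
      then have "s N - l \<in> vecs ?L" using close[of N 1 N] by simp
      from L.diff_vecs[OF s this, of N] show ?thesis by simp
    qed
    moreover have "(\<lambda>k. hnorm ?L (s k - l)) \<longlonglongrightarrow> 0"
    proof (rule LIMSEQ_I)
      fix e :: real assume "0 < e"
      then obtain N where N: "\<forall>k\<ge>N. \<forall>m\<ge>N. hnorm ?L (s k - s m) < e / 2"
        using Cauchy[of "e / 2"] by auto
      have "norm (hnorm ?L (s k - l) - 0) < e" if "k \<ge> N" for k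
        using close[OF N _ that] \<open>0 < e\<close> L.hnorm_nonneg[of "s k - l"] by simp
      then show "\<exists>N. \<forall>k\<ge>N. norm (hnorm ?L (s k - l) - 0) < e" by blast
    qed
    ultimately show "\<exists>l\<in>vecs ?L. (\<lambda>k. hnorm ?L (s k - l)) \<longlonglongrightarrow> 0" by blast
  qed
qed

section \<open>Functions vanishing at infinity\<close>

text \<open>
  The functional calculus of \<open>C\<^sub>0(X)\<close>. The condition \<open>\<phi> 0 = 0\<close> keeps the function small at infinity
  and preserves the value \<open>0\<close> outside the space.
\<close>

lemma C0_compose:
  assumes f: "f \<in> C0 X" and \<phi>: "continuous_on UNIV \<phi>" "\<phi> 0 = 0"
  shows "(\<lambda>x. \<phi> (f x)) \<in> C0 X"
proof -
  have cont: "continuous_map X euclidean (\<lambda>x. \<phi> (f x))"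
    using f \<phi>(1) continuous_map_compose[of X euclidean f euclidean \<phi>] by (simp add: C0_def o_def)
  have "compactin X {x \<in> topspace X. e \<le> cmod (\<phi> (f x))}" if "0 < e" for e
  proof -
    have "\<exists>d>0. \<forall>z. dist z 0 < d \<longrightarrow> dist (\<phi> z) (\<phi> 0) < e"
      using \<phi>(1) that unfolding continuous_on_iff by blast
    then obtain d where d: "d > 0" "\<And>z. cmod z < d \<Longrightarrow> cmod (\<phi> z) < e"
      using \<phi>(2) by auto
    have "closedin X {x \<in> topspace X. \<phi> (f x) \<in> {z. e \<le> cmod z}}"
      by (rule closedin_continuous_map_preimage[OF cont])
        (simp add: closed_Collect_le continuous_on_norm continuous_on_id continuous_on_const)
    moreover have "compactin X {x \<in> topspace X. d \<le> cmod (f x)}"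
      using f d(1) by (simp add: C0_def)
    moreover have "{x \<in> topspace X. e \<le> cmod (\<phi> (f x))} \<subseteq> {x \<in> topspace X. d \<le> cmod (f x)}"
      using d(2) not_less by blast
    ultimately show ?thesis using closed_compactin by fastforce
  qed
  then show ?thesis using f cont \<phi>(2) by (simp add: C0_def)
qed

lemma C0_cnj: "f \<in> C0 X \<Longrightarrow> (\<lambda>x. cnj (f x)) \<in> C0 X"
  by (rule C0_compose) (auto intro!: continuous_intros)

lemma C0_bounded:
  assumes f: "f \<in> C0 X"
  obtains c where "0 < c" "\<And>x. cmod (f x) \<le> c"
proof -
  have "compactin X {x \<in> topspace X. 1 \<le> cmod (f x)}" "continuous_map X euclidean f"
    using f by (simp_all add: C0_def)
  then have "compactin euclidean (f ` {x \<in> topspace X. 1 \<le> cmod (f x)})"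
    by (rule image_compactin)
  then have "bounded (f ` {x \<in> topspace X. 1 \<le> cmod (f x)})"
    by (simp add: compact_imp_bounded)
  then obtain b where b: "0 < b" "\<And>x. x \<in> topspace X \<Longrightarrow> 1 \<le> cmod (f x) \<Longrightarrow> cmod (f x) \<le> b"
    by (auto simp: bounded_pos)
  have "cmod (f x) \<le> max 1 b" for x
  proof (cases "x \<in> topspace X")
    case True
    then show ?thesis using b(2)[of x] by linarith
  next
    case False
    then show ?thesis using f by (simp add: C0_def)
  qed
  then show thesis by (intro that[of "max 1 b"]) auto
qed

section \<open>Pullback along words and representations\<close>

text \<open>
  For the word \<open>i\<^sub>1 \<dots> i\<^sub>m\<close> this is \<open>f \<circ> \<sigma> i\<^sub>1 \<circ> \<dots> \<circ> \<sigma> i\<^sub>m\<close>. The first letter is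
  composed first, so that prepending a letter to the word amounts to replacing \<open>f\<close> by \<open>f \<circ> \<sigma> i\<close>.
\<close>

primrec pullback :: "'x topology \<Rightarrow> ('i \<Rightarrow> 'x \<Rightarrow> 'x) \<Rightarrow> 'i list \<Rightarrow> ('x \<Rightarrow> complex) \<Rightarrow> 'x \<Rightarrow> complex" where
  "pullback X \<sigma> [] f = f"
| "pullback X \<sigma> (i # w) f = pullback X \<sigma> w (comp_on X f (\<sigma> i))"

lemma comp_on_pointwise:
  shows comp_on_add: "comp_on X (\<lambda>x. f x + g x) s = (\<lambda>x. comp_on X f s x + comp_on X g s x)"
    and comp_on_scale: "comp_on X (\<lambda>x. c * f x) s = (\<lambda>x. c * comp_on X f s x)"
    and comp_on_mult: "comp_on X (\<lambda>x. f x * g x) s = (\<lambda>x. comp_on X f s x * comp_on X g s x)"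
    and comp_on_cnj: "comp_on X (\<lambda>x. cnj (f x)) s = (\<lambda>x. cnj (comp_on X f s x))"
  by (auto simp: comp_on_def)

lemma pullback_pointwise:
  shows pullback_add: "pullback X \<sigma> w (\<lambda>x. f x + g x) = (\<lambda>x. pullback X \<sigma> w f x + pullback X \<sigma> w g x)"
    and pullback_scale: "pullback X \<sigma> w (\<lambda>x. c * f x) = (\<lambda>x. c * pullback X \<sigma> w f x)"
    and pullback_mult: "pullback X \<sigma> w (\<lambda>x. f x * g x) = (\<lambda>x. pullback X \<sigma> w f x * pullback X \<sigma> w g x)"
    and pullback_cnj: "pullback X \<sigma> w (\<lambda>x. cnj (f x)) = (\<lambda>x. cnj (pullback X \<sigma> w f x))"
  by (induction w arbitrary: f g) (simp_all add: comp_on_pointwise)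

lemma pullback_bound:
  assumes "\<And>x. cmod (f x) \<le> c" "0 \<le> c"
  shows "cmod (pullback X \<sigma> w f x) \<le> c"
  using assms(1)
proof (induction w arbitrary: f)
  case (Cons i w)
  have "cmod (comp_on X f (\<sigma> i) x) \<le> c" for x
    using Cons.prems assms(2) by (simp add: comp_on_def)
  then show ?case by (simp add: Cons.IH)
qed simp

locale C0_representation = complex_hilbert_space H
  for H :: "('h::ab_group_add) inner_space" +
  fixes X :: "'x topology" and \<pi> :: "('x \<Rightarrow> complex) \<Rightarrow> 'h \<Rightarrow> 'h"
  assumes rep: "star_representation X H \<pi>"
begin

lemma rep_linear: "f \<in> C0 X \<Longrightarrow> linear_map_between H H (\<pi> f)"
  using rep by (simp add: star_representation_def bounded_operator_def)

lemmas rep_vecs = linear_map_vecs[OF rep_linear]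

lemma rep_zero: "f \<in> C0 X \<Longrightarrow> \<pi> f 0 = 0"
  using linear_map_add[OF rep_linear zero_vecs zero_vecs, of f] by simp

lemma
  assumes "f \<in> C0 X" "v \<in> vecs H"
  shows rep_add: "g \<in> C0 X \<Longrightarrow> \<pi> (\<lambda>x. f x + g x) v = \<pi> f v + \<pi> g v"
    and rep_scale: "\<pi> (\<lambda>x. c * f x) v = smul H c (\<pi> f v)"
    and rep_mult: "g \<in> C0 X \<Longrightarrow> \<pi> (\<lambda>x. f x * g x) v = \<pi> f (\<pi> g v)"
    and rep_cnj: "w \<in> vecs H \<Longrightarrow> ip H (\<pi> (\<lambda>x. cnj (f x)) v) w = ip H v (\<pi> f w)"
  using assms rep by (auto simp: star_representation_def)

lemma rep_adjoint:
  assumes "f \<in> C0 X" "v \<in> vecs H" "w \<in> vecs H"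
  shows "ip H (\<pi> f v) w = ip H v (\<pi> (\<lambda>x. cnj (f x)) w)"
  using rep_cnj[OF C0_cnj[OF assms(1)] assms(2,3)] by simp

text \<open>
  With \<open>q = 1 - (1 - \<bar>g\<bar>\<^sup>2)\<^sup>1\<^sup>/\<^sup>2\<close> one has \<open>\<bar>g\<bar>\<^sup>2 = 2 q - q\<^sup>2\<close>, hence
  \<open>\<parallel>\<pi> g v\<parallel>\<^sup>2 = \<parallel>v\<parallel>\<^sup>2 - \<parallel>v - \<pi> q v\<parallel>\<^sup>2\<close>. The point of \<open>q\<close> is that, unlike
  \<open>(1 - \<bar>g\<bar>\<^sup>2)\<^sup>1\<^sup>/\<^sup>2\<close>, it vanishes at infinity, so that no unit has to be adjoined to
  \<open>C\<^sub>0(X)\<close>.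
\<close>

lemma rep_norm_le_one:
  assumes g: "g \<in> C0 X" and g_le: "\<And>x. cmod (g x) \<le> 1" and v: "v \<in> vecs H"
  shows "hnorm H (\<pi> g v) \<le> hnorm H v"
proof -
  define q where "q = (\<lambda>x. complex_of_real (1 - sqrt (1 - (cmod (g x))\<^sup>2)))"
  have q: "q \<in> C0 X"
    unfolding q_def by (rule C0_compose[OF g]) (auto intro!: continuous_intros)
  have qq: "(\<lambda>x. q x * q x) \<in> C0 X"
    by (rule C0_compose[OF q]) (auto intro!: continuous_intros)
  have scaled: "(\<lambda>x. 2 * q x) \<in> C0 X" "(\<lambda>x. - 1 * (q x * q x)) \<in> C0 X"
    by (rule C0_compose[OF q] C0_compose[OF qq]; auto intro!: continuous_intros)+
  have identity: "(\<lambda>x. cnj (g x) * g x) = (\<lambda>x. 2 * q x + - 1 * (q x * q x))"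
  proof
    fix x
    have "(sqrt (1 - (cmod (g x))\<^sup>2))\<^sup>2 = 1 - (cmod (g x))\<^sup>2"
      using g_le[of x] by (simp add: power_le_one)
    then have "(cmod (g x))\<^sup>2 = 2 * (1 - sqrt (1 - (cmod (g x))\<^sup>2))
        - (1 - sqrt (1 - (cmod (g x))\<^sup>2)) * (1 - sqrt (1 - (cmod (g x))\<^sup>2))"
      by (simp add: algebra_simps power2_eq_square)
    then have "complex_of_real ((cmod (g x))\<^sup>2) = 2 * q x - q x * q x"
      unfolding q_def by (metis of_real_diff of_real_mult of_real_numeral)
    then show "cnj (g x) * g x = 2 * q x + - 1 * (q x * q x)"
      using complex_norm_square[of "g x"] by (simp add: mult.commute)
  qed
  have q_real: "(\<lambda>x. cnj (q x)) = q" by (simp add: q_def)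
  note vecs = v rep_vecs[OF g v] rep_vecs[OF q v] rep_vecs[OF q rep_vecs[OF q v]]
  have "ip H (\<pi> g v) (\<pi> g v) = ip H (\<pi> (\<lambda>x. cnj (g x) * g x) v) v"
    using g v by (simp add: rep_mult C0_cnj rep_cnj rep_vecs)
  also have "\<dots> = 2 * ip H (\<pi> q v) v - ip H (\<pi> q (\<pi> q v)) v"
    unfolding identity rep_add[OF scaled(1) v scaled(2)] rep_scale[OF q v] rep_scale[OF qq v]
      rep_mult[OF q v q]
    using vecs by (simp add: ip_add_left ip_smul_left smul_vecs)
  also have "ip H (\<pi> q (\<pi> q v)) v = ip H (\<pi> q v) (\<pi> q v)"
    using rep_adjoint[OF q vecs(3) v] by (simp add: q_real)
  finally have "(hnorm H (\<pi> g v))\<^sup>2 = (hnorm H v)\<^sup>2 - (hnorm H (v - \<pi> q v))\<^sup>2"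
    using vecs Re_ip_commute[of v "\<pi> q v"] by (simp add: hnorm_squared_diff hnorm_squared)
  then show ?thesis
    by (intro power2_le_imp_le[OF _ hnorm_nonneg[OF v]]) simp
qed

lemma rep_norm_le:
  assumes g: "g \<in> C0 X" and c: "0 < c" "\<And>x. cmod (g x) \<le> c" and v: "v \<in> vecs H"
  shows "hnorm H (\<pi> g v) \<le> c * hnorm H v"
proof -
  define h where "h = (\<lambda>x. of_real (1 / c) * g x)"
  have h: "h \<in> C0 X"
    unfolding h_def by (rule C0_compose[OF g]) (use c(1) in \<open>auto intro!: continuous_intros\<close>)
  have "cmod (h x) \<le> 1" for x
    using c by (simp add: h_def norm_mult norm_divide)
  then have "hnorm H (\<pi> h v) \<le> hnorm H v" by (rule rep_norm_le_one[OF h _ v])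
  moreover have "g = (\<lambda>x. of_real c * h x)" using c(1) by (simp add: h_def fun_eq_iff)
  ultimately show ?thesis
    using c(1) h v by (metis abs_of_pos hnorm_smul mult_left_mono norm_of_real order_less_imp_le
        rep_scale rep_vecs)
qed

end


section \<open>The dilation on words\<close>

text \<open>
  The alphabet is a whole type, with a map and a contraction for every letter, so that words need no
  side condition.
\<close>

locale contractive_covariant_system = C0_representation H X \<pi>
  for H :: "('h::ab_group_add) inner_space" and X :: "'x topology" and \<pi> +
  fixes \<sigma> :: "'i \<Rightarrow> 'x \<Rightarrow> 'x" and A :: "'i \<Rightarrow> 'h \<Rightarrow> 'h"
  assumes \<sigma>: "continuous_map X X (\<sigma> i)" "proper_map X X (\<sigma> i)"
    and A: "contraction H (A i)"
    and covariance: "\<lbrakk>f \<in> C0 X; x \<in> vecs H\<rbrakk> \<Longrightarrow> \<pi> f (A i x) = A i (\<pi> (comp_on X f (\<sigma> i)) x)"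
begin

lemma comp_on_C0: "f \<in> C0 X \<Longrightarrow> comp_on X f (\<sigma> i) \<in> C0 X"
  by (intro comp_on_in_C0 \<sigma>)

lemma pullback_C0: "f \<in> C0 X \<Longrightarrow> pullback X \<sigma> w f \<in> C0 X"
  by (induction w arbitrary: f) (simp_all add: comp_on_C0)

lemmas A_linear = contraction_linear[OF A]
lemmas A_vecs = linear_map_vecs[OF A_linear]

definition is_defect :: "'i \<Rightarrow> ('h \<Rightarrow> 'h) \<Rightarrow> bool" where
  "is_defect i D \<longleftrightarrow> linear_map_between H H D \<and>
     (\<forall>x\<in>vecs H. (hnorm H (A i x))\<^sup>2 + (hnorm H (D x))\<^sup>2 = (hnorm H x)\<^sup>2) \<and>
     (\<forall>f\<in>C0 X. \<forall>x\<in>vecs H. D (\<pi> (comp_on X f (\<sigma> i)) x) = \<pi> (comp_on X f (\<sigma> i)) (D x))"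

text \<open>
  With \<open>g = f \<circ> \<sigma> i\<close>, the form \<open>\<langle>A x, A y\<rangle>\<close> is unchanged when \<open>\<pi> g\<close> is moved from \<open>x\<close> to \<open>y\<close> as
  \<open>\<pi> (cnj g)\<close>: the covariance relation turns \<open>A (\<pi> g x)\<close> into \<open>\<pi> f (A x)\<close>, whose adjoint is
  \<open>\<pi> (cnj f)\<close>, and the relation for \<open>cnj f\<close> moves it back inside.
\<close>

lemma defect_exists: "\<exists>D. is_defect i D"
proof (rule defect_operator[OF A[of i]])
  fix D assume D: "linear_map_between H H D"
    and isometric: "\<And>x. x \<in> vecs H \<Longrightarrow> (hnorm H (A i x))\<^sup>2 + (hnorm H (D x))\<^sup>2 = (hnorm H x)\<^sup>2"
    and commutes: "\<And>P Q x. \<lbrakk>\<And>x. x \<in> vecs H \<Longrightarrow> P x \<in> vecs H; \<And>x. x \<in> vecs H \<Longrightarrow> Q x \<in> vecs H;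
            \<And>x y. \<lbrakk>x \<in> vecs H; y \<in> vecs H\<rbrakk> \<Longrightarrow> ip H (P x) y = ip H x (Q y);
            \<And>x y. \<lbrakk>x \<in> vecs H; y \<in> vecs H\<rbrakk> \<Longrightarrow> ip H (A i (P x)) (A i y) = ip H (A i x) (A i (Q y));
            x \<in> vecs H\<rbrakk> \<Longrightarrow> D (P x) = P (D x)"
  have "D (\<pi> (comp_on X f (\<sigma> i)) x) = \<pi> (comp_on X f (\<sigma> i)) (D x)"
    if f: "f \<in> C0 X" and x: "x \<in> vecs H" for f x
  proof (rule commutes[where Q = "\<pi> (\<lambda>x. cnj (comp_on X f (\<sigma> i) x))"])
    note g = comp_on_C0[OF f, of i]
    show "\<pi> (comp_on X f (\<sigma> i)) v \<in> vecs H" "\<pi> (\<lambda>x. cnj (comp_on X f (\<sigma> i) x)) v \<in> vecs H"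
      if "v \<in> vecs H" for v
      using that g by (simp_all add: rep_vecs C0_cnj)
    show "ip H (\<pi> (comp_on X f (\<sigma> i)) v) w = ip H v (\<pi> (\<lambda>x. cnj (comp_on X f (\<sigma> i) x)) w)"
      if "v \<in> vecs H" "w \<in> vecs H" for v w
      using that g by (rule rep_adjoint[rotated 1])
    show "ip H (A i (\<pi> (comp_on X f (\<sigma> i)) v)) (A i w)
        = ip H (A i v) (A i (\<pi> (\<lambda>x. cnj (comp_on X f (\<sigma> i) x)) w))"
      if "v \<in> vecs H" "w \<in> vecs H" for v w
      using that f covariance[OF C0_cnj[OF f], of w i] rep_adjoint[of f "A i v" "A i w"]
      by (simp add: covariance[symmetric] A_vecs comp_on_cnj)
  qed (rule x)
  with D isometric show ?thesis unfolding is_defect_def by blast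
qed

definition defect :: "'i \<Rightarrow> 'h \<Rightarrow> 'h" where
  "defect i = (SOME D. is_defect i D)"

lemma
  shows defect_linear: "linear_map_between H H (defect i)"
    and defect_isometric: "x \<in> vecs H \<Longrightarrow> (hnorm H (A i x))\<^sup>2 + (hnorm H (defect i x))\<^sup>2 = (hnorm H x)\<^sup>2"
    and defect_commutes: "\<lbrakk>f \<in> C0 X; x \<in> vecs H\<rbrakk> \<Longrightarrow>
        defect i (\<pi> (comp_on X f (\<sigma> i)) x) = \<pi> (comp_on X f (\<sigma> i)) (defect i x)"
proof -
  have "is_defect i (defect i)"
    unfolding defect_def by (rule someI_ex[OF defect_exists])
  then show "linear_map_between H H (defect i)"
    and "x \<in> vecs H \<Longrightarrow> (hnorm H (A i x))\<^sup>2 + (hnorm H (defect i x))\<^sup>2 = (hnorm H x)\<^sup>2"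
    and "\<lbrakk>f \<in> C0 X; x \<in> vecs H\<rbrakk> \<Longrightarrow>
        defect i (\<pi> (comp_on X f (\<sigma> i)) x) = \<pi> (comp_on X f (\<sigma> i)) (defect i x)"
    unfolding is_defect_def by blast+
qed

abbreviation K :: "('i list \<Rightarrow> 'h) inner_space" where
  "K \<equiv> l2_space H"

sublocale K: complex_hilbert_space K
  by (rule l2_hilbert_space)

definition embed :: "'h \<Rightarrow> 'i list \<Rightarrow> 'h" where
  "embed x w = (if w = [] then x else 0)"

definition word_rep :: "('x \<Rightarrow> complex) \<Rightarrow> ('i list \<Rightarrow> 'h) \<Rightarrow> 'i list \<Rightarrow> 'h" where
  "word_rep f k w = \<pi> (pullback X \<sigma> w f) (k w)"

definition dilation :: "'i \<Rightarrow> ('i list \<Rightarrow> 'h) \<Rightarrow> 'i list \<Rightarrow> 'h" where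
  "dilation i k w = (case w of
       [] \<Rightarrow> A i (k [])
     | j # u \<Rightarrow> if j \<noteq> i then 0 else if u = [] then defect i (k []) else k u)"

lemma dilation_simps:
  "dilation i k [] = A i (k [])"
  "dilation i k (j # u) = (if j \<noteq> i then 0 else if u = [] then defect i (k []) else k u)"
  by (simp_all add: dilation_def)

lemma embed_facts:
  assumes "x \<in> vecs H"
  shows embed_vecs: "embed x \<in> vecs K" and hnorm_embed: "hnorm K (embed x) = hnorm H x"
proof -
  have "((\<lambda>w. (hnorm H (embed x w))\<^sup>2) has_sum (hnorm H x)\<^sup>2) UNIV"
    by (rule has_sum_finite_neutralI[where B = "{[]}"]) (simp_all add: embed_def hnorm_zero)
  moreover have "embed x w \<in> vecs H" for w
    using assms zero_vecs by (simp add: embed_def)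
  ultimately show "embed x \<in> vecs K" "hnorm K (embed x) = hnorm H x"
    by (rule l2_hnorm_eq[OF hnorm_nonneg[OF assms]])+
qed

lemma embed_isometry: "linear_isometry H K embed"
  unfolding linear_isometry_def linear_map_between_def
  by (auto simp: embed_vecs hnorm_embed) (auto simp: embed_def fun_eq_iff smul_zero_right)

lemma orth_compl_embed: "orth_compl K (embed ` vecs H) = {k \<in> vecs K. k [] = 0}"
proof -
  have ip_embed: "ip K k (embed x) = ip H (k []) x" if "k \<in> vecs K" "x \<in> vecs H" for k x
    unfolding ip_l2
    by (intro infsumI has_sum_finite_neutralI[where B = "{[]}"])
      (use that in \<open>simp_all add: embed_def ip_zero_right l2_component\<close>)
  have "k [] = 0 \<longleftrightarrow> (\<forall>x\<in>vecs H. ip H (k []) x = 0)" if "k \<in> vecs K" for k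
    using ip_pos[OF l2_component[OF that, of "[]"]] ip_zero_left l2_component[OF that] by fastforce
  then show ?thesis by (auto simp: orth_compl_def ip_embed)
qed

text \<open>
  The bound \<open>c\<close> for \<open>\<bar>f\<bar>\<close> is also a bound for all pullbacks of \<open>f\<close>, which makes the operators on the
  copies of \<open>H\<close> uniformly bounded.
\<close>

lemma word_rep_bounded:
  assumes f: "f \<in> C0 X"
  obtains c where "\<And>k. k \<in> vecs K \<Longrightarrow> word_rep f k \<in> vecs K"
    and "\<And>k. k \<in> vecs K \<Longrightarrow> hnorm K (word_rep f k) \<le> c * hnorm K k"
proof -
  obtain c where c: "0 < c" "\<And>x. cmod (f x) \<le> c" using C0_bounded[OF f] by blast
  have *: "word_rep f k \<in> vecs K \<and> hnorm K (word_rep f k) \<le> c * hnorm K k" if k: "k \<in> vecs K" for k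
  proof -
    have le: "hnorm H (word_rep f k w) \<le> c * hnorm H (k w)" for w
      unfolding word_rep_def
      using c by (intro rep_norm_le pullback_C0 f pullback_bound l2_component[OF k]) auto
    have vec: "word_rep f k w \<in> vecs H" for w
      unfolding word_rep_def by (intro rep_vecs pullback_C0 f l2_component[OF k])
    have "(\<Sum>w\<in>F. (hnorm H (word_rep f k w))\<^sup>2) \<le> (c * hnorm K k)\<^sup>2" if "finite F" for F
    proof -
      have "(\<Sum>w\<in>F. (hnorm H (word_rep f k w))\<^sup>2) \<le> (\<Sum>w\<in>F. c\<^sup>2 * (hnorm H (k w))\<^sup>2)"
        using le vec by (intro sum_mono) (metis hnorm_nonneg power_mono power_mult_distrib)
      also have "\<dots> = c\<^sup>2 * (\<Sum>w\<in>F. (hnorm H (k w))\<^sup>2)" by (rule sum_distrib_left[symmetric])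
      also have "\<dots> \<le> c\<^sup>2 * (hnorm K k)\<^sup>2"
        by (intro mult_left_mono l2_sum_le_hnorm_squared k that) simp
      finally show ?thesis by (simp add: power_mult_distrib)
    qed
    with vec c(1) K.hnorm_nonneg[OF k] show ?thesis
      using l2_bounded_sums[of "word_rep f k" "c * hnorm K k"] by simp
  qed
  then show thesis by (intro that[of c]) simp_all
qed

lemma word_rep_bounded_operator:
  assumes f: "f \<in> C0 X"
  shows "bounded_operator K (word_rep f)"
proof -
  obtain c where c: "\<And>k. k \<in> vecs K \<Longrightarrow> word_rep f k \<in> vecs K"
    "\<And>k. k \<in> vecs K \<Longrightarrow> hnorm K (word_rep f k) \<le> c * hnorm K k"
    using word_rep_bounded[OF f] by blast
  have "word_rep f (k + l) = word_rep f k + word_rep f l" if "k \<in> vecs K" "l \<in> vecs K" for k l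
    using that
    by (simp add: word_rep_def fun_eq_iff linear_map_add[OF rep_linear[OF pullback_C0[OF f]]] l2_component)
  moreover have "word_rep f (smul K a k) = smul K a (word_rep f k)" if "k \<in> vecs K" for a k
    using that
    by (simp add: word_rep_def fun_eq_iff linear_map_smul[OF rep_linear[OF pullback_C0[OF f]]] l2_component)
  ultimately show ?thesis
    unfolding bounded_operator_def linear_map_between_def using c by blast
qed

lemma word_rep_representation: "star_representation X K word_rep"
  unfolding star_representation_def
proof (intro conjI ballI allI)
  show "bounded_operator K (word_rep f)" if "f \<in> C0 X" for f
    using that by (rule word_rep_bounded_operator)
  fix f k assume f: "f \<in> C0 X" and k: "k \<in> vecs K"
  note C0 = pullback_C0[OF f] and comp = l2_component[OF k]
  show "word_rep (\<lambda>x. c * f x) k = smul K c (word_rep f k)" for c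
    by (simp add: word_rep_def fun_eq_iff pullback_scale rep_scale[OF C0 comp])
  show "word_rep (\<lambda>x. f x + g x) k = word_rep f k + word_rep g k" if "g \<in> C0 X" for g
    by (simp add: word_rep_def fun_eq_iff pullback_add rep_add[OF C0 comp] pullback_C0 that)
  show "word_rep (\<lambda>x. f x * g x) k = word_rep f (word_rep g k)" if "g \<in> C0 X" for g
    by (simp add: word_rep_def fun_eq_iff pullback_mult rep_mult[OF C0 comp] pullback_C0 that)
  show "ip K (word_rep (\<lambda>x. cnj (f x)) k) l = ip K k (word_rep f l)" if "l \<in> vecs K" for l
    by (simp add: ip_l2 word_rep_def pullback_cnj rep_cnj[OF C0 comp] l2_component[OF that])
qed

text \<open>
  The values of the image live at the empty word, where the squared norm is that of \<open>A i (k [])\<close>, and at the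
  words beginning with \<open>i\<close>. Reindexed by the remaining word, the latter are the values of \<open>k\<close>
  with \<open>defect i (k [])\<close> in place of \<open>k []\<close>.
\<close>

lemma dilation_isometry: "linear_isometry K K (dilation i)"
proof -
  have *: "dilation i k \<in> vecs K \<and> hnorm K (dilation i k) = hnorm K k" if k: "k \<in> vecs K" for k
  proof -
    let ?k = "\<lambda>w. (hnorm H (k w))\<^sup>2" and ?S = "\<lambda>w. (hnorm H (dilation i k w))\<^sup>2"
    let ?D = "(hnorm H (defect i (k [])))\<^sup>2"
    have "((\<lambda>w. ?k w + (if w = [] then ?D - ?k [] else 0)) has_sum ((hnorm K k)\<^sup>2 + (?D - ?k []))) UNIV"
      by (intro has_sum_add l2_norm_has_sum[OF k] has_sum_finite_neutralI[where B = "{[]}"]) simp_all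
    also have "(\<lambda>w. ?k w + (if w = [] then ?D - ?k [] else 0)) = ?S \<circ> (#) i"
      by (auto simp: fun_eq_iff dilation_simps)
    finally have "(?S has_sum ((hnorm K k)\<^sup>2 + (?D - ?k []))) ((#) i ` UNIV)"
      by (simp add: has_sum_reindex o_def)
    moreover have "(?S has_sum (?S [])) {[]}"
      by (rule has_sum_finite_neutralI[where B = "{[]}"]) simp_all
    ultimately have "(?S has_sum (?S [] + ((hnorm K k)\<^sup>2 + (?D - ?k [])))) ({[]} \<union> (#) i ` UNIV)"
      by (intro has_sum_Un_disjoint) auto
    also have "?S [] + ((hnorm K k)\<^sup>2 + (?D - ?k [])) = (hnorm K k)\<^sup>2"
      using defect_isometric[OF l2_component[OF k], of i "[]"] by (simp add: dilation_simps)
    finally have "(?S has_sum (hnorm K k)\<^sup>2) ({[]} \<union> (#) i ` UNIV)" .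
    moreover have "?S w = 0" if "w \<notin> {[]} \<union> (#) i ` UNIV" for w
      using that by (cases w) (auto simp: dilation_simps hnorm_zero)
    ultimately have "(?S has_sum (hnorm K k)\<^sup>2) UNIV"
      by (subst has_sum_cong_neutral[where S = UNIV and T = "{[]} \<union> (#) i ` UNIV" and g = ?S]) auto
    moreover have "dilation i k w \<in> vecs H" for w
      by (cases w) (simp_all add: dilation_simps A_vecs linear_map_vecs[OF defect_linear]
          l2_component[OF k] zero_vecs)
    ultimately show ?thesis
      using l2_hnorm_eq[OF K.hnorm_nonneg[OF k]] by blast
  qed
  moreover have "dilation i (k + l) = dilation i k + dilation i l" if "k \<in> vecs K" "l \<in> vecs K" for k l
    using that by (auto simp: fun_eq_iff dilation_def linear_map_add[OF A_linear]
        linear_map_add[OF defect_linear] l2_component split: list.split)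
  moreover have "dilation i (smul K a k) = smul K a (dilation i k)" if "k \<in> vecs K" for a k
    using that by (auto simp: fun_eq_iff dilation_def linear_map_smul[OF A_linear]
        linear_map_smul[OF defect_linear] l2_component smul_zero_right split: list.split)
  ultimately show ?thesis
    unfolding linear_isometry_def linear_map_between_def by blast
qed

text \<open>
  At the empty word this is the covariance of \<open>A\<close>, at the word \<open>i\<close> the commutation of the defect
  operator with \<open>\<pi> (f \<circ> \<sigma> i)\<close>, and at longer words the recursion for the pullback.
\<close>

lemma dilation_covariance:
  assumes f: "f \<in> C0 X" and k: "k \<in> vecs K"
  shows "word_rep f (dilation i k) = dilation i (word_rep (comp_on X f (\<sigma> i)) k)"
proof
  fix w
  show "word_rep f (dilation i k) w = dilation i (word_rep (comp_on X f (\<sigma> i)) k) w"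
    using f l2_component[OF k]
    by (cases w) (simp_all add: word_rep_def dilation_simps covariance defect_commutes
        rep_zero pullback_C0 comp_on_C0)
qed

lemma word_rep_embed: "f \<in> C0 X \<Longrightarrow> word_rep f (embed x) = embed (\<pi> f x)"
  by (auto simp: word_rep_def embed_def fun_eq_iff rep_zero pullback_C0)

lemma embed_reduces:
  assumes f: "f \<in> C0 X"
  shows "reduces K (embed ` vecs H) (word_rep f)"
  unfolding reduces_def invariant_under_def orth_compl_embed
proof (intro conjI image_subsetI)
  fix k assume "k \<in> {k \<in> vecs K. k [] = 0}"
  moreover obtain c where "\<And>k. k \<in> vecs K \<Longrightarrow> word_rep f k \<in> vecs K"
    using word_rep_bounded[OF f] by blast
  ultimately show "word_rep f k \<in> {k \<in> vecs K. k [] = 0}"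
    using f by (simp add: word_rep_def rep_zero)
qed (use f in \<open>auto simp: word_rep_embed rep_vecs\<close>)

lemma dilation_vecs: "k \<in> vecs K \<Longrightarrow> dilation i k \<in> vecs K"
  using dilation_isometry[of i] by (auto simp: linear_isometry_def linear_map_between_def)

lemma dilation_invariant: "invariant_under (dilation i) (orth_compl K (embed ` vecs H))"
  unfolding invariant_under_def orth_compl_embed
  using linear_map_add[OF A_linear zero_vecs zero_vecs, of i]
  by (auto simp: dilation_vecs dilation_simps)

lemma dilation_compression:
  assumes x: "x \<in> vecs H"
  shows "orth_proj K (embed ` vecs H) (dilation i (embed x)) = embed (A i x)"
proof -
  have S: "dilation i (embed x) \<in> vecs K" by (intro dilation_vecs embed_vecs x)
  have corner: "dilation i (embed x) [] = A i x" by (simp add: dilation_simps embed_def)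
  show ?thesis
    unfolding orth_proj_def orth_compl_embed
  proof (rule the_equality)
    show "embed (A i x) \<in> embed ` vecs H \<and>
        dilation i (embed x) - embed (A i x) \<in> {k \<in> vecs K. k [] = 0}"
      using S x by (auto simp: K.diff_vecs embed_vecs A_vecs corner embed_def)
  next
    fix p
    assume "p \<in> embed ` vecs H \<and> dilation i (embed x) - p \<in> {k \<in> vecs K. k [] = 0}"
    then show "p = embed (A i x)" by (auto simp: corner embed_def)
  qed
qed

end


theorem proposition2p12:
  fixes X :: "'x topology"
    and n :: nat
    and \<sigma> :: "nat \<Rightarrow> 'x \<Rightarrow> 'x"
    and H :: "('h::ab_group_add) inner_space"
    and \<pi> :: "('x \<Rightarrow> complex) \<Rightarrow> 'h \<Rightarrow> 'h"
    and A :: "nat \<Rightarrow> 'h \<Rightarrow> 'h"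
  assumes "multivariable_system X n \<sigma>"
    and "complex_hilbert_space H"
    and "star_representation X H \<pi>"
    and "\<forall>i\<in>{1..n}. contraction H (A i)"
    and "\<forall>f\<in>C0 X. \<forall>i\<in>{1..n}. \<forall>h\<in>vecs H. \<pi> f (A i h) = A i (\<pi> (comp_on X f (\<sigma> i)) h)"
  shows "\<exists>(K :: (nat list \<Rightarrow> 'h) inner_space) (V :: 'h \<Rightarrow> (nat list \<Rightarrow> 'h))
            (\<rho> :: ('x \<Rightarrow> complex) \<Rightarrow> (nat list \<Rightarrow> 'h) \<Rightarrow> (nat list \<Rightarrow> 'h))
            (S :: nat \<Rightarrow> (nat list \<Rightarrow> 'h) \<Rightarrow> (nat list \<Rightarrow> 'h)).
      complex_hilbert_space K \<and> linear_isometry H K V \<and>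
      star_representation X K \<rho> \<and>
      (\<forall>i\<in>{1..n}. linear_isometry K K (S i)) \<and>
      (\<forall>f\<in>C0 X. \<forall>i\<in>{1..n}. \<forall>k\<in>vecs K. \<rho> f (S i k) = S i (\<rho> (comp_on X f (\<sigma> i)) k)) \<and>
      (\<forall>f\<in>C0 X. reduces K (V ` vecs H) (\<rho> f)) \<and>
      (\<forall>f\<in>C0 X. \<forall>h\<in>vecs H. \<rho> f (V h) = V (\<pi> f h)) \<and>
      (\<forall>i\<in>{1..n}. invariant_under (S i) (orth_compl K (V ` vecs H))) \<and>
      (\<forall>i\<in>{1..n}. \<forall>h\<in>vecs H. orth_proj K (V ` vecs H) (S i (V h)) = V (A i h))"
proof -
  \<comment> \<open>Letters outside \<open>1, \<dots>, n\<close> get the trivial system: the identity map and the contraction \<open>0\<close>.\<close>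
  define \<sigma>' where "\<sigma>' = (\<lambda>i. if i \<in> {1..n} then \<sigma> i else id)"
  define A' where "A' = (\<lambda>i. if i \<in> {1..n} then A i else (\<lambda>_. 0))"
  interpret H: complex_hilbert_space H by fact
  interpret \<pi>: C0_representation H X \<pi> by unfold_locales fact
  interpret D: contractive_covariant_system H X \<pi> \<sigma>' A'
  proof
    fix i :: nat
    show "continuous_map X X (\<sigma>' i)" "proper_map X X (\<sigma>' i)"
      using assms(1) by (auto simp: \<sigma>'_def multivariable_system_def)
    show "contraction H (A' i)"
      using assms(4) by (auto simp: A'_def contraction_def linear_map_between_def H.zero_vecs
          H.smul_zero_right H.hnorm_zero H.hnorm_nonneg)
    show "\<pi> f (A' i x) = A' i (\<pi> (comp_on X f (\<sigma>' i)) x)" if "f \<in> C0 X" "x \<in> vecs H" for f x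
      using assms(5) that by (auto simp: A'_def \<sigma>'_def \<pi>.rep_zero)
  qed
  have in_range: "\<sigma>' i = \<sigma> i" "A' i = A i" if "i \<in> {1..n}" for i
    using that by (simp_all add: \<sigma>'_def A'_def)
  show ?thesis
  proof (intro exI conjI ballI)
    show "complex_hilbert_space D.K" by (rule H.l2_hilbert_space)
    show "linear_isometry H D.K D.embed" by (rule D.embed_isometry)
    show "star_representation X D.K D.word_rep" by (rule D.word_rep_representation)
    show "linear_isometry D.K D.K (D.dilation i)" for i by (rule D.dilation_isometry)
    show "D.word_rep f (D.dilation i k) = D.dilation i (D.word_rep (comp_on X f (\<sigma> i)) k)"
      if "f \<in> C0 X" "i \<in> {1..n}" "k \<in> vecs D.K" for f i k
      using D.dilation_covariance[OF that(1,3), of i] by (simp only: in_range[OF that(2)])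
    show "reduces D.K (D.embed ` vecs H) (D.word_rep f)" if "f \<in> C0 X" for f
      using that by (rule D.embed_reduces)
    show "D.word_rep f (D.embed h) = D.embed (\<pi> f h)" if "f \<in> C0 X" for f h
      using that by (rule D.word_rep_embed)
    show "invariant_under (D.dilation i) (orth_compl D.K (D.embed ` vecs H))" for i
      by (rule D.dilation_invariant)
    show "orth_proj D.K (D.embed ` vecs H) (D.dilation i (D.embed h)) = D.embed (A i h)"
      if "i \<in> {1..n}" "h \<in> vecs H" for i h
      using D.dilation_compression[OF that(2), of i] by (simp only: in_range[OF that(1)])
  qed
qed

end
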